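(* Let $\lambda$ be a cardinal with $\lambda>|V|$ and $\lambda^\omega=\lambda$, where $V$ is the standard universe. Then there exists a nonstandard universe ${}^*V$ such that every hyperfinite Loeb space $\Omega$ in ${}^*V$ has $|\Omega|=\lambda$ and is not compact.
   Context: Work in ZFC. The standard universe $V$ is built over $\mathbb{N}$: $V_0=\mathbb{N}$, $V_{n+1}=V_n\cup\mathcal{P}(V_n)$, $V=\bigcup_n V_n$ (so $|V|=\beth_\omega$). A nonstandard universe ${}^*V$ is the truncation at ${}^*\!\in$-rank $\omega$ of an elementary extension of $(V,\in)$ with ${}^*\mathbb{N}\setminus\mathbb{N}\neq\emptyset$, always required to be $\omega_1$-saturated. A hyperfinite Loeb space: for $H\in{}^*\mathbb{N}\setminus\mathbb{N}$, $\Omega=\{1,\dots,H\}$, $P(A)={}^*|A|/H$ for internal $A\subseteq\Omega$; $(\Omega,\Sigma,L_P)$ is the Loeb measure space generated by the internal subsets and $\mathrm{st}\circ P$ (completed). $|\Omega|$ denotes external cardinality. A family $\mathcal{C}\subseteq\Sigma$ is compact if every subfamily with the finite intersection property has nonempty intersection, and inner-regular if $L_P(A)=\sup\{L_P(C):C\subseteq A,\ C\in\mathcal{C}\}$ for all $A\in\Sigma$. $\Omega$ is compact if it carries an inner-regular compact family. *)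

theory Defs
  imports "HOL-Analysis.Analysis"
begin

unbundle cardinal_syntax

section \<open>The standard universe\<close>

text \<open>
  A superstructure over the natural numbers has the size of the \<open>\<omega>\<close>-th beth number, which no type
  built from \<^typ>\<open>nat\<close> reaches. So it is carried by an arbitrary type \<open>'v\<close>: \<open>num\<close> embeds
  the natural numbers as atoms, and \<open>mk A\<close> is the element of \<open>'v\<close> that stands for the set \<open>A\<close>.
  Only the values of \<open>mk\<close> on subsets of some level matter. This fixes the universe up to
  isomorphism.
\<close>

primrec vlev :: "(nat \<Rightarrow> 'v) \<Rightarrow> ('v set \<Rightarrow> 'v) \<Rightarrow> nat \<Rightarrow> 'v set" where
  "vlev num mk 0 = range num"
| "vlev num mk (Suc n) = vlev num mk n \<union> mk ` Pow (vlev num mk n)"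

definition std_univ :: "(nat \<Rightarrow> 'v) \<Rightarrow> ('v set \<Rightarrow> 'v) \<Rightarrow> 'v set" where
  "std_univ num mk = (\<Union>n. vlev num mk n)"

definition vbounded :: "(nat \<Rightarrow> 'v) \<Rightarrow> ('v set \<Rightarrow> 'v) \<Rightarrow> 'v set \<Rightarrow> bool" where
  "vbounded num mk A \<longleftrightarrow> (\<exists>n. A \<subseteq> vlev num mk n)"

definition std_mem :: "(nat \<Rightarrow> 'v) \<Rightarrow> ('v set \<Rightarrow> 'v) \<Rightarrow> 'v \<Rightarrow> 'v \<Rightarrow> bool" where
  "std_mem num mk x y \<longleftrightarrow> (\<exists>A. vbounded num mk A \<and> y = mk A \<and> x \<in> A)"

locale superstructure =
  fixes num :: "nat \<Rightarrow> 'v" and mk :: "'v set \<Rightarrow> 'v"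
  assumes inj_num: "inj num"
    and inj_mk: "inj_on mk (Collect (vbounded num mk))"
    and mk_not_num: "vbounded num mk A \<Longrightarrow> mk A \<notin> range num"
begin

definition natset :: 'v where
  "natset = mk (range num)"

definition vpair :: "'v \<Rightarrow> 'v \<Rightarrow> 'v" where
  "vpair x y = mk {mk {x}, mk {x, y}}"

definition le_code :: 'v where
  "le_code = mk {vpair (num m) (num n) | m n. m \<le> n}"

definition card_code :: 'v where
  "card_code = mk {vpair (mk (num ` A)) (num (card A)) | A. finite A}"

text \<open>Real numbers are coded as Dedekind cuts, with rationals enumerated by natural numbers.\<close>

definition rcut :: "real \<Rightarrow> 'v" where
  "rcut r = mk {num (to_nat q) | q::rat. of_rat q < r}"

definition div_code :: 'v where
  "div_code = mk {vpair (vpair (num m) (num n)) (rcut (real m / real n)) | m n. n > 0}"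

end


section \<open>Elementary embeddings in the language of membership\<close>

datatype fm = Mem nat nat | Eq nat nat | Neg fm | Conj fm fm | All nat fm

primrec sat :: "'m set \<Rightarrow> ('m \<Rightarrow> 'm \<Rightarrow> bool) \<Rightarrow> (nat \<Rightarrow> 'm) \<Rightarrow> fm \<Rightarrow> bool" where
  "sat M E e (Mem i j) \<longleftrightarrow> E (e i) (e j)"
| "sat M E e (Eq i j) \<longleftrightarrow> e i = e j"
| "sat M E e (Neg p) \<longleftrightarrow> \<not> sat M E e p"
| "sat M E e (Conj p q) \<longleftrightarrow> sat M E e p \<and> sat M E e q"
| "sat M E e (All i p) \<longleftrightarrow> (\<forall>a\<in>M. sat M E (e(i := a)) p)"

definition elementary_embedding ::
  "'a set \<Rightarrow> ('a \<Rightarrow> 'a \<Rightarrow> bool) \<Rightarrow> 'b set \<Rightarrow> ('b \<Rightarrow> 'b \<Rightarrow> bool) \<Rightarrow> ('a \<Rightarrow> 'b) \<Rightarrow> bool" where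
  "elementary_embedding N F M E j \<longleftrightarrow>
    j ` N \<subseteq> M \<and> (\<forall>p e. range e \<subseteq> N \<longrightarrow> (sat N F e p \<longleftrightarrow> sat M E (j \<circ> e) p))"


section \<open>Nonstandard universes\<close>

text \<open>
  The truncation of an elementary extension \<open>M\<close> at rank \<open>\<omega>\<close>: those elements that \<open>M\<close> believes
  to lie in some level of standard finite index.
\<close>

definition truncation ::
  "(nat \<Rightarrow> 'v) \<Rightarrow> ('v set \<Rightarrow> 'v) \<Rightarrow> 'm set \<Rightarrow> ('m \<Rightarrow> 'm \<Rightarrow> bool) \<Rightarrow> ('v \<Rightarrow> 'm) \<Rightarrow> 'm set" where
  "truncation num mk M E star = {x \<in> M. \<exists>n. E x (star (mk (vlev num mk n)))}"

text \<open>
  Countable saturation in the sense of nonstandard analysis: the elements of \<open>U\<close> (seen through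
  \<open>E\<close>) are the internal sets. Atoms have no members, so they are excluded by the finite
  intersection property.
\<close>

definition omega1_saturated :: "'m set \<Rightarrow> ('m \<Rightarrow> 'm \<Rightarrow> bool) \<Rightarrow> bool" where
  "omega1_saturated U E \<longleftrightarrow>
    (\<forall>F. F \<subseteq> U \<and> countable F \<and> (\<forall>G. finite G \<and> G \<subseteq> F \<longrightarrow> (\<exists>x\<in>U. \<forall>a\<in>G. E x a))
       \<longrightarrow> (\<exists>x\<in>U. \<forall>a\<in>F. E x a))"

locale nonstandard_universe = superstructure num mk
  for num :: "nat \<Rightarrow> 'v" and mk :: "'v set \<Rightarrow> 'v" +
  fixes M :: "'m set" and E :: "'m \<Rightarrow> 'm \<Rightarrow> bool" and star :: "'v \<Rightarrow> 'm"
  assumes elementary: "elementary_embedding (std_univ num mk) (std_mem num mk) M E star"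
    and proper: "\<exists>H\<in>M. E H (star (mk (range num))) \<and> H \<notin> star ` range num"
    and saturated: "omega1_saturated (truncation num mk M E star) E"
begin

definition U :: "'m set" where
  "U = truncation num mk M E star"

definition ext :: "'m \<Rightarrow> 'm set" where
  "ext a = {x \<in> U. E x a}"

definition hypernat :: "'m set" where
  "hypernat = ext (star natset)"

definition infinite_hypernat :: "'m set" where
  "infinite_hypernat = hypernat - star ` range num"

definition internal_sets :: "'m set" where
  "internal_sets = U - hypernat"

definition star_pair :: "'m \<Rightarrow> 'm \<Rightarrow> 'm" where
  "star_pair x y = (THE p. p \<in> internal_sets \<and>
     (\<exists>a\<in>internal_sets. \<exists>b\<in>internal_sets. ext a = {x} \<and> ext b = {x, y} \<and> ext p = {a, b}))"

definition star_app :: "'m \<Rightarrow> 'm \<Rightarrow> 'm" where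
  "star_app f x = (THE y. y \<in> U \<and> star_pair x y \<in> ext f)"

definition hyper_le :: "'m \<Rightarrow> 'm \<Rightarrow> bool" where
  "hyper_le x y \<longleftrightarrow> star_pair x y \<in> ext (star le_code)"

text \<open>
  The standard part of a finite hyperreal \<open>y\<close> is the real \<open>r\<close> such that \<open>y\<close> belongs to the
  nonstandard extension of every interval \<open>{x. \<bar>x - r\<bar> < \<epsilon>}\<close> with real \<open>\<epsilon> > 0\<close>.
\<close>

definition st :: "'m \<Rightarrow> real" where
  "st y = (THE r. \<forall>\<epsilon>>0. y \<in> ext (star (mk (rcut ` {x. \<bar>x - r\<bar> < \<epsilon>}))))"

definition Omega :: "'m \<Rightarrow> 'm set" where
  "Omega H = {x \<in> hypernat. hyper_le (star (num 1)) x \<and> hyper_le x H}"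

definition internal_subsets :: "'m \<Rightarrow> 'm set" where
  "internal_subsets H = {a \<in> internal_sets. ext a \<subseteq> Omega H}"

definition hypercard :: "'m \<Rightarrow> 'm" where
  "hypercard a = star_app (star card_code) a"

definition P :: "'m \<Rightarrow> 'm \<Rightarrow> 'm" where
  "P H a = star_app (star div_code) (star_pair (hypercard a) H)"

definition loeb_space :: "'m \<Rightarrow> 'm measure" where
  "loeb_space H =
     completion (extend_measure (Omega H) (internal_subsets H) ext (\<lambda>a. ennreal (st (P H a))))"

end


section \<open>Compact measure spaces\<close>

definition compact_family :: "'a set set \<Rightarrow> bool" where
  "compact_family C \<longleftrightarrow>
    (\<forall>D\<subseteq>C. (\<forall>F. finite F \<and> F \<subseteq> D \<longrightarrow> \<Inter>F \<noteq> {}) \<longrightarrow> \<Inter>D \<noteq> {})"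

definition inner_regular_family :: "'a measure \<Rightarrow> 'a set set \<Rightarrow> bool" where
  "inner_regular_family \<mu> C \<longleftrightarrow>
    (\<forall>A\<in>sets \<mu>. emeasure \<mu> A = (SUP B\<in>{B \<in> C. B \<subseteq> A}. emeasure \<mu> B))"

definition compact_measure_space :: "'a measure \<Rightarrow> bool" where
  "compact_measure_space \<mu> \<longleftrightarrow>
    (\<exists>C\<subseteq>sets \<mu>. compact_family C \<and> inner_regular_family \<mu> C)"

end

(*
Let kap be the successor of the continuum and K = kap x lam, ordered lexicographically. The
nonstandard universe is a limit ultrapower: functions into V that depend on countably many of the
coordinates indexed by K (and on one natural number, which provides saturation), modulo an
ultrafilter. The ultrafilter is built by recursion on K so that the coordinate k codes, for every
infinite hypernatural H depending on coordinates below k, an internal subset of {1..H} of at most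
half the size of H that contains all points depending on coordinates below k. Points outside these
sets show that {1..H} has lam elements.

For k = (b, i) with b < kap let A b be the complement of the set coded by k; it has Loeb measure at
least 1/2, while every point lies in A b only for b in a bounded subset of kap. If C were an
inner-regular compact family, choose positive C b <= A b in it. A pressing-down argument shows
that kap is a precaliber of every finite measure: unboundedly many of the sets C b have
the finite intersection property. By compactness they share a point, a contradiction.
*)
theory Submission
  imports Defs
begin

section \<open>Successor cardinals\<close>

text \<open>One order of stages has to do two jobs. Non-compactness needs a length that is a
  precaliber of every finite measure, whereas the size needs \<lambda> new points, and the
  cofinality of \<lambda> is not under control; hence \<open>kap\<close> blocks, each of length
  \<lambda>. The successor of the continuum is regular, and a set of at most continuum many stages
  has only continuum many countable subsets, so pressing down can make whole countable families
  constant and not merely their bounds. Countable supports serve every side: each lies below a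
  single block, they are preserved by the pointwise choices behind the theorem of Los and behind
  saturation, and \<lambda>^\<omega> = \<lambda> keeps the number of functions down. The ultrafilter
  cannot be generated from a list of requirements fixed in advance, because which hypernaturals are
  infinite depends on the ultrafilter itself; a coordinate is constrained only once the earlier ones
  are settled. Constraints on one coordinate are consistent since finitely many points never exceed
  half of an infinite H.\<close>

type_synonym stage = "nat set set"

abbreviation kap :: "stage rel" where
  "kap \<equiv> cardSuc |UNIV :: nat set set|"

lemma Cinfinite_nat_set: "Cinfinite |UNIV :: nat set set|"
  by (simp add: cinfinite_def Field_card_of Finite_Set.finite_set card_of_card_order_on)

text \<open>A successor cardinal is regular, so the small set \<open>S\<close> is not cofinal; as
  there is no last element, the bound can be made strict.\<close>

lemma strictly_bounded_cardSuc:
  assumes r: "Cinfinite r" and S: "S \<subseteq> Field (cardSuc r)" "|S| \<le>o r"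
  obtains b where "b \<in> Field (cardSuc r)" "S \<subseteq> underS (cardSuc r) b"
proof -
  let ?r = "cardSuc r"
  have C: "Cinfinite ?r" by (rule Cinfinite_cardSuc[OF r])
  have wo: "wo_rel ?r" using C unfolding card_order_on_def wo_rel_def by auto
  have "|S| <o ?r" using S(2) r by (simp add: cardSuc_ordLeq_ordLess[symmetric] card_of_Card_order)
  then have "\<not> |S| =o ?r" using not_ordLess_ordIso by blast
  then have "\<not> cofinal S ?r"
    using regularCard_cardSuc[OF r] S(1) unfolding regularCard_def by blast
  then obtain a where a: "a \<in> Field ?r" "\<And>b. b \<in> S \<Longrightarrow> a = b \<or> (a, b) \<notin> ?r"
    unfolding cofinal_def by blast
  obtain b where b: "b \<in> Field ?r" "a \<noteq> b" "(a, b) \<in> ?r"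
    using infinite_Card_order_limit[of ?r a] C a unfolding cinfinite_def by blast
  have "(s, b) \<in> ?r \<and> s \<noteq> b" if "s \<in> S" for s
  proof -
    have "(s, a) \<in> ?r"
      using a(2)[OF that] wo_rel.TOTALS[OF wo] that S(1) a(1) wo_rel.REFL[OF wo]
      unfolding refl_on_def by blast
    then show ?thesis
      using b wo_rel.TRANS[OF wo] wo_rel.ANTISYM[OF wo] unfolding trans_def antisym_def by metis
  qed
  then show thesis using b(1) that by (auto simp: underS_def)
qed

lemma card_underS_cardSuc:
  assumes "Card_order r" "b \<in> Field (cardSuc r)"
  shows "|underS (cardSuc r) b| \<le>o r"
  using card_of_underS[OF cardSuc_Card_order[OF assms(1)] assms(2)] assms(1)
  by (simp add: cardSuc_ordLeq_ordLess card_of_Card_order)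

lemma wf_underS: "Well_order r \<Longrightarrow> wf (r - Id)"
  unfolding well_order_on_def by blast

lemma countable_iff_le: "countable A \<longleftrightarrow> |A| \<le>o |UNIV :: nat set|"
  unfolding countable_def by (simp add: card_of_ordLeq[symmetric])

text \<open>This is the equation (2^\<omega>)^\<omega> = 2^\<omega>: countably many sets of naturals
  are coded by a single one.\<close>

lemma card_countable_subsets:
  assumes "|A| \<le>o |UNIV :: nat set set|"
  shows "|{X. X \<subseteq> A \<and> countable X}| \<le>o |UNIV :: nat set set|"
proof -
  obtain f :: "'a \<Rightarrow> nat set" where f: "inj_on f A"
    using assms by (auto simp: card_of_ordLeq[symmetric])
  define D where "D = (\<lambda>c :: nat set. {x \<in> A. \<exists>n. f x = {m. prod_encode (Suc n, m) \<in> c} \<and> prod_encode (0, n) \<in> c})"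
  have "{X. X \<subseteq> A \<and> countable X} \<subseteq> range D"
  proof
    fix X assume "X \<in> {X. X \<subseteq> A \<and> countable X}"
    then have X: "X \<subseteq> A" "countable X" by auto
    define c where "c = (\<lambda>x. prod_encode (0, to_nat_on X x)) ` X \<union>
      {prod_encode (Suc (to_nat_on X x), m) | x m. x \<in> X \<and> m \<in> f x}"
    have 1: "{m. prod_encode (Suc (to_nat_on X x), m) \<in> c} = f x" if "x \<in> X" for x
      using that inj_on_to_nat_on[OF X(2)] unfolding c_def inj_on_def by fastforce
    have 2: "prod_encode (0, n) \<in> c \<longleftrightarrow> n \<in> to_nat_on X ` X" for n
      unfolding c_def by (fastforce simp: image_iff)
    have "x \<in> D c" if "x \<in> X" for x
      unfolding D_def 2
      by (rule CollectI, intro conjI exI[of _ "to_nat_on X x"]) (use that X(1) 1[OF that] in auto)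
    moreover have "x \<in> X" if x: "x \<in> D c" for x
    proof -
      obtain y where "y \<in> X" "f x = {m. prod_encode (Suc (to_nat_on X y), m) \<in> c}" "x \<in> A"
        using x unfolding D_def 2 by blast
      then show ?thesis using 1[of y] f X(1) unfolding inj_on_def by (metis subsetD)
    qed
    ultimately have "X = D c" by blast
    then show "X \<in> range D" by blast
  qed
  then show ?thesis by (rule surj_imp_ordLeq)
qed

text \<open>The point \<open>b\<close> is the supremum of an increasing sequence of length \<open>\<omega>\<^sub>1\<close>, closed under \<open>e\<close> at
  each step; a countable set below \<open>b\<close> is therefore bounded below \<open>b\<close>.\<close>

lemma exists_closed_point:
  assumes e: "\<And>c. c \<in> Field kap \<Longrightarrow> e c \<in> Field kap"
  obtains b where "b \<in> Field kap"
    "\<And>J. countable J \<Longrightarrow> J \<subseteq> underS kap b \<Longrightarrow> \<exists>c\<in>underS kap b. J \<subseteq> underS kap c \<and> e c \<in> underS kap b"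
proof -
  let ?w = "cardSuc natLeq"
  have wC: "Cinfinite ?w" by (rule Cinfinite_cardSuc[OF natLeq_Cinfinite])
  have wwo: "Well_order ?w" and kwo: "Well_order kap" and kwr: "wo_rel kap"
    using wC Cinfinite_cardSuc[OF Cinfinite_nat_set] unfolding card_order_on_def wo_rel_def by auto
  \<comment> \<open>With the guard \<open>g j \<in> Field kap\<close>, the condition has a solution
    at every position of \<omega>_1 whatever \<open>g\<close> does earlier, so the choice in the
    recursion succeeds without an induction along it.\<close>
  define Q where "Q = (\<lambda>g i b. b \<in> Field kap \<and>
      (\<forall>j\<in>underS ?w i. g j \<in> Field kap \<longrightarrow> g j \<in> underS kap b \<and> e (g j) \<in> underS kap b))"
  define g where "g = wfrec (?w - Id) (\<lambda>g i. SOME b. Q g i b)"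
  have geq: "g i = (SOME b. Q g i b)" for i
  proof -
    have "g i = (SOME b. Q (cut g (?w - Id) i) i b)"
      unfolding g_def by (subst wfrec[OF wf_underS[OF wwo]]) simp
    also have "Q (cut g (?w - Id) i) i = Q g i"
      by (auto simp: Q_def underS_def cut_apply fun_eq_iff)
    finally show ?thesis .
  qed
  have Qg: "Q g i (g i)" if "i \<in> Field ?w" for i
  proof -
    let ?G = "g ` underS ?w i \<inter> Field kap"
    have "|underS ?w i| \<le>o natLeq"
      by (rule card_underS_cardSuc[OF natLeq_Card_order that])
    then have "countable (underS ?w i)"
      unfolding countable_iff_le by (metis card_of_nat ordIso_iff_ordLeq ordLeq_transitive)
    then have "countable (?G \<union> e ` ?G)" by simp
    then have "|?G \<union> e ` ?G| \<le>o |UNIV :: nat set|" by (simp add: countable_iff_le)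
    also have "|UNIV :: nat set| \<le>o |UNIV :: nat set set|"
      using card_of_Pow[of "UNIV :: nat set"] by (simp add: ordLess_imp_ordLeq)
    finally obtain b where "b \<in> Field kap" "?G \<union> e ` ?G \<subseteq> underS kap b"
      using strictly_bounded_cardSuc[OF Cinfinite_nat_set, of "?G \<union> e ` ?G"] e by blast
    then have "Q g i b" by (auto simp: Q_def)
    then show ?thesis by (subst geq) (rule someI)
  qed
  let ?G = "g ` Field ?w"
  have GF: "?G \<subseteq> Field kap" using Qg by (auto simp: Q_def)
  have "?w \<le>o |UNIV :: nat set set|"
    using card_of_Pow[of "UNIV :: nat set"]
    by (simp add: cardSuc_ordLess_ordLeq[symmetric] natLeq_Card_order card_of_Card_order)
      (metis card_of_nat ordIso_ordLess_trans ordIso_symmetric)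
  then have "|Field ?w| \<le>o |UNIV :: nat set set|"
    using card_of_Field_ordIso wC by (blast intro: ordIso_ordLeq_trans)
  then have "|?G| \<le>o |UNIV :: nat set set|"
    using card_of_image ordLeq_transitive by blast
  then obtain b0 where b0: "b0 \<in> Field kap" "?G \<subseteq> underS kap b0"
    using strictly_bounded_cardSuc[OF Cinfinite_nat_set GF] by blast
  obtain b where b: "b \<in> {b \<in> Field kap. ?G \<subseteq> underS kap b}"
    and bmin: "\<And>c. (c, b) \<in> kap - Id \<Longrightarrow> c \<notin> {b \<in> Field kap. ?G \<subseteq> underS kap b}"
    using wfE_min[OF wf_underS[OF kwo], of b0] b0 by (metis (no_types, lifting) mem_Collect_eq)
  show thesis
  proof (rule that[of b])
    show "b \<in> Field kap" using b by blast
    fix J assume J: "countable J" "J \<subseteq> underS kap b"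
    have "\<forall>x\<in>J. \<exists>i. i \<in> Field ?w \<and> (x, g i) \<in> kap"
    proof
      fix x assume "x \<in> J"
      then have xb: "(x, b) \<in> kap - Id" using J(2) by (auto simp: underS_def)
      then have xF: "x \<in> Field kap" by (auto simp: Field_def)
      then obtain i where i: "i \<in> Field ?w" "g i \<notin> underS kap x" using bmin[OF xb] by auto
      then have "(x, g i) \<in> kap"
        using wo_rel.TOTALS[OF kwr] wo_rel.REFL[OF kwr] xF GF unfolding underS_def refl_on_def by blast
      with i show "\<exists>i. i \<in> Field ?w \<and> (x, g i) \<in> kap" by blast
    qed
    from bchoice[OF this] obtain ix where ix: "\<And>x. x \<in> J \<Longrightarrow> ix x \<in> Field ?w \<and> (x, g (ix x)) \<in> kap"
      by blast
    have "|ix ` J| \<le>o natLeq"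
      using J(1) countable_iff_le[of "ix ` J"] by (metis card_of_nat countable_image ordLeq_ordIso_trans)
    then obtain i where i: "i \<in> Field ?w" "ix ` J \<subseteq> underS ?w i"
      using strictly_bounded_cardSuc[OF natLeq_Cinfinite, of "ix ` J"] ix by blast
    obtain i' where i': "i' \<in> Field ?w" "i \<in> underS ?w i'"
      using infinite_Card_order_limit[of ?w i] wC i(1) unfolding cinfinite_def underS_def by blast
    have gb: "g i \<in> underS kap b" "g i' \<in> underS kap b" using b i(1) i'(1) by auto
    have "e (g i) \<in> underS kap (g i')"
      using Qg[OF i'(1)] i'(2) i(1) GF unfolding Q_def by blast
    then have "e (g i) \<in> underS kap b"
      using gb(2) wo_rel.TRANS[OF kwr] wo_rel.ANTISYM[OF kwr] unfolding underS_def trans_def antisym_def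
      by (metis (mono_tags, lifting) mem_Collect_eq)
    moreover have "x \<in> underS kap (g i)" if "x \<in> J" for x
    proof -
      have "g (ix x) \<in> underS kap (g i)"
        using Qg[OF i(1)] i(2) GF ix[OF that] that unfolding Q_def by blast
      then show ?thesis
        using ix[OF that] wo_rel.TRANS[OF kwr] wo_rel.ANTISYM[OF kwr] unfolding underS_def trans_def antisym_def
        by (metis (mono_tags, lifting) mem_Collect_eq)
    qed
    ultimately show "\<exists>c\<in>underS kap b. J \<subseteq> underS kap c \<and> e c \<in> underS kap b"
      using gb(1) by blast
  qed
qed

section \<open>Unbounded sets of stages and pressing down\<close>

definition kap_unbounded :: "stage set \<Rightarrow> bool" where
  "kap_unbounded T \<longleftrightarrow> T \<subseteq> Field kap \<and> (\<forall>c\<in>Field kap. \<exists>b\<in>T. c \<in> underS kap b)"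

text \<open>Suppose that for every \<open>c\<close> the stages \<open>b\<close> with
  \<open>\<Union>(\<F> b)\<close> below \<open>c\<close> were bounded, by \<open>e c\<close>. A
  stage closed under \<open>e\<close> refutes this, because there the countable set
  \<open>\<Union>(\<F> b)\<close> is already bounded. Below the resulting \<open>c\<close> only
  continuum many values of \<open>\<F> b\<close> remain, too few to cut an unbounded set of stages
  into bounded pieces.\<close>

lemma pressing_down:
  fixes \<F> :: "stage \<Rightarrow> stage set set"
  assumes cnt: "\<And>b. b \<in> Field kap \<Longrightarrow> countable (\<F> b)"
    and fin: "\<And>b F. b \<in> Field kap \<Longrightarrow> F \<in> \<F> b \<Longrightarrow> finite F \<and> F \<subseteq> underS kap b"
  obtains T \<G> where "kap_unbounded T" "\<And>b. b \<in> T \<Longrightarrow> \<F> b = \<G>"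
proof -
  have kwr: "wo_rel kap"
    using Cinfinite_cardSuc[OF Cinfinite_nat_set] unfolding card_order_on_def wo_rel_def by auto
  have cJ: "countable (\<Union>(\<F> b))" if "b \<in> Field kap" for b
    using countable_UN[of "\<F> b" "\<lambda>F. F"] cnt[OF that] fin[OF that] by (simp add: countable_finite)
  have "\<exists>c\<in>Field kap. \<forall>d\<in>Field kap. \<exists>b\<in>Field kap. d \<in> underS kap b \<and> \<Union>(\<F> b) \<subseteq> underS kap c"
  proof (rule ccontr)
    assume "\<not> ?thesis"
    then have "\<forall>c\<in>Field kap. \<exists>d. d\<in>Field kap \<and> (\<forall>b\<in>Field kap. d \<in> underS kap b \<longrightarrow> \<not> \<Union>(\<F> b) \<subseteq> underS kap c)"
      by blast
    from bchoice[OF this] obtain e where e: "\<And>c. c \<in> Field kap \<Longrightarrow> e c \<in> Field kap"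
      "\<And>c b. c \<in> Field kap \<Longrightarrow> b \<in> Field kap \<Longrightarrow> e c \<in> underS kap b \<Longrightarrow> \<not> \<Union>(\<F> b) \<subseteq> underS kap c" by blast
    obtain b where b: "b \<in> Field kap"
      "\<And>J. countable J \<Longrightarrow> J \<subseteq> underS kap b \<Longrightarrow> \<exists>c\<in>underS kap b. J \<subseteq> underS kap c \<and> e c \<in> underS kap b"
      using exists_closed_point[of e] e(1) by blast
    have "\<Union>(\<F> b) \<subseteq> underS kap b" using fin[OF b(1)] by blast
    from b(2)[OF cJ[OF b(1)] this] obtain c where
      "c \<in> underS kap b" "\<Union>(\<F> b) \<subseteq> underS kap c" "e c \<in> underS kap b" by blast
    moreover have "c \<in> Field kap" using \<open>c \<in> underS kap b\<close> by (auto simp: underS_def Field_def)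
    ultimately show False using e(2) b(1) by blast
  qed
  then obtain c where c: "c \<in> Field kap"
    "\<And>d. d \<in> Field kap \<Longrightarrow> \<exists>b\<in>Field kap. d \<in> underS kap b \<and> \<Union>(\<F> b) \<subseteq> underS kap c" by blast
  \<comment> \<open>Countable families of countable sets below \<open>c\<close>: counting countable
    subsets twice keeps their number at the continuum.\<close>
  let ?Z = "{X. X \<subseteq> {Y. Y \<subseteq> underS kap c \<and> countable Y} \<and> countable X}"
  have "|underS kap c| \<le>o |UNIV :: nat set set|"
    by (rule card_underS_cardSuc[OF card_of_Card_order c(1)])
  then have cZ: "|?Z| \<le>o |UNIV :: nat set set|" by (intro card_countable_subsets)
  have "\<exists>\<G>. kap_unbounded {b \<in> Field kap. \<F> b = \<G>}"
  proof (rule ccontr)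
    assume "\<not> ?thesis"
    then have nk: "\<not> kap_unbounded {b \<in> Field kap. \<F> b = \<G>}" for \<G> by simp
    have "\<forall>\<G>. \<exists>d. d \<in> Field kap \<and> (\<forall>b\<in>Field kap. \<F> b = \<G> \<longrightarrow> d \<notin> underS kap b)"
    proof
      fix \<G>
      have "\<not> (\<forall>d\<in>Field kap. \<exists>b\<in>{b \<in> Field kap. \<F> b = \<G>}. d \<in> underS kap b)"
        using nk[of \<G>] unfolding kap_unbounded_def by (simp only: Collect_restrict simp_thms)
      then show "\<exists>d. d \<in> Field kap \<and> (\<forall>b\<in>Field kap. \<F> b = \<G> \<longrightarrow> d \<notin> underS kap b)"
        by blast
    qed
    from choice[OF this] obtain d where
      dd: "\<forall>\<G>. d \<G> \<in> Field kap \<and> (\<forall>b\<in>Field kap. \<F> b = \<G> \<longrightarrow> d \<G> \<notin> underS kap b)" ..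
    then have d: "d \<G> \<in> Field kap" for \<G> by simp
    have dZ: "|d ` ?Z| \<le>o |UNIV :: nat set set|"
      using card_of_image cZ ordLeq_transitive by blast
    have "d ` ?Z \<subseteq> Field kap" using d by (rule image_subsetI)
    from strictly_bounded_cardSuc[OF Cinfinite_nat_set this dZ]
    obtain m where m: "m \<in> Field kap" "d ` ?Z \<subseteq> underS kap m" .
    obtain b where b: "b \<in> Field kap" "m \<in> underS kap b" "\<Union>(\<F> b) \<subseteq> underS kap c"
      using c(2)[OF m(1)] by blast
    have "\<F> b \<in> ?Z"
      using b(3) cnt[OF b(1)] fin[OF b(1)] by (auto intro: countable_finite)
    then have "d (\<F> b) \<in> underS kap m" using m(2) by blast
    then have "d (\<F> b) \<in> underS kap b"
      using b(2) wo_rel.TRANS[OF kwr] wo_rel.ANTISYM[OF kwr] unfolding underS_def trans_def antisym_def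
      by (metis (mono_tags, lifting) mem_Collect_eq)
    then show False using dd b(1) by blast
  qed
  then obtain \<G> where "kap_unbounded {b \<in> Field kap. \<F> b = \<G>}" by blast
  then show thesis using that[of "{b \<in> Field kap. \<F> b = \<G>}" \<G>] by blast
qed


section \<open>A precaliber of measure algebras\<close>

text \<open>The supremum of the measures of countable unions is attained by joining a maximizing
  sequence. One further set cannot raise it, so that set is covered up to a null set.\<close>

lemma (in finite_measure) countable_essential_union:
  assumes "\<And>i. i \<in> I \<Longrightarrow> D i \<in> sets M"
  obtains G where "countable G" "G \<subseteq> I" "\<And>i. i \<in> I \<Longrightarrow> measure M (D i - (\<Union>j\<in>G. D j)) = 0"
proof -
  let ?\<C> = "{G. countable G \<and> G \<subseteq> I}"
  let ?m = "\<lambda>G. measure M (\<Union>j\<in>G. D j)"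
  have meas: "(\<Union>j\<in>G. D j) \<in> sets M" if "G \<in> ?\<C>" for G
    using that assms by (intro sets.countable_UN'') auto
  have bdd: "bdd_above (?m ` ?\<C>)" by (intro bdd_aboveI[of _ "measure M (space M)"]) (auto simp: bounded_measure)
  have "\<exists>G\<in>?\<C>. Sup (?m ` ?\<C>) - 1 / real (Suc n) < ?m G" for n
  proof -
    have "Sup (?m ` ?\<C>) - 1 / real (Suc n) < Sup (?m ` ?\<C>)" by simp
    moreover have "?m ` ?\<C> \<noteq> {}" by blast
    ultimately obtain y where "y \<in> ?m ` ?\<C>" "Sup (?m ` ?\<C>) - 1 / real (Suc n) < y"
      by (rule less_cSupE)
    then show ?thesis by blast
  qed
  then have "\<forall>n. \<exists>G. G \<in> ?\<C> \<and> Sup (?m ` ?\<C>) - 1 / real (Suc n) < ?m G" by blast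
  from choice[OF this] obtain g where "\<forall>n. g n \<in> ?\<C> \<and> Sup (?m ` ?\<C>) - 1 / real (Suc n) < ?m (g n)" ..
  then have g: "\<And>n. g n \<in> ?\<C>" "\<And>n. Sup (?m ` ?\<C>) - 1 / real (Suc n) < ?m (g n)" by simp_all
  define G where "G = (\<Union>n. g n)"
  have GC: "G \<in> ?\<C>" using g(1) by (auto simp: G_def)
  have ub: "?m G' \<le> Sup (?m ` ?\<C>)" if "G' \<in> ?\<C>" for G'
    using that bdd by (intro cSup_upper) auto
  have ge: "Sup (?m ` ?\<C>) \<le> ?m G"
  proof (rule field_le_epsilon)
    fix e :: real assume "0 < e"
    then obtain n where n: "1 / real (Suc n) < e" using nat_approx_posE by metis
    have "?m (g n) \<le> ?m G"
      using meas[OF GC] by (intro finite_measure_mono) (auto simp: G_def)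
    then show "Sup (?m ` ?\<C>) \<le> ?m G + e" using g(2)[of n] n by linarith
  qed
  show thesis
  proof (rule that[of G])
    fix i assume i: "i \<in> I"
    have GC': "insert i G \<in> ?\<C>" using GC i by auto
    have "measure M ((\<Union>j\<in>insert i G. D j) - (\<Union>j\<in>G. D j)) = ?m (insert i G) - ?m G"
      using meas[OF GC] meas[OF GC'] by (intro finite_measure_Diff) auto
    also have "\<dots> \<le> 0" using ub[OF GC'] ge by linarith
    also have "(\<Union>j\<in>insert i G. D j) - (\<Union>j\<in>G. D j) = D i - (\<Union>j\<in>G. D j)" by blast
    finally show "measure M (D i - (\<Union>j\<in>G. D j)) = 0"
      using measure_nonneg[of M "D i - (\<Union>j\<in>G. D j)"] by linarith
  qed (use GC in auto)
qed

text \<open>\<open>N b\<close> collects the finite sets of earlier stages whose intersection is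
  killed by \<open>C b\<close>; countably many of them, \<open>\<F> b\<close>, exhaust the union up
  to a null set. Pressing down makes this countable witness the same family \<open>\<G>\<close> on
  an unbounded \<open>T\<close>, so its union \<open>Z\<close> is null inside every
  \<open>C b\<close> with \<open>b \<in> T\<close>.\<close>

lemma (in finite_measure) kap_precaliber:
  assumes C: "\<And>b. b \<in> Field kap \<Longrightarrow> C b \<in> sets M"
    and pos: "\<And>b. b \<in> Field kap \<Longrightarrow> 0 < measure M (C b)"
  obtains T where "kap_unbounded T"
    "\<And>F. finite F \<Longrightarrow> F \<subseteq> T \<Longrightarrow> F \<noteq> {} \<Longrightarrow> (\<Inter>b\<in>F. C b) \<noteq> {}"
proof -
  have kwr: "wo_rel kap"
    using Cinfinite_cardSuc[OF Cinfinite_nat_set] unfolding card_order_on_def wo_rel_def by auto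
  define D where "D = (\<lambda>F. space M \<inter> (\<Inter>b\<in>F. C b))"
  define N where "N = (\<lambda>b. {F. finite F \<and> F \<subseteq> underS kap b \<and> measure M (D F \<inter> C b) = 0})"
  have uF: "underS kap b \<subseteq> Field kap" for b by (auto simp: underS_def Field_def)
  have D: "D F \<in> sets M" if "finite F" "F \<subseteq> Field kap" for F
  proof (cases "F = {}")
    case False
    then have "(\<Inter>b\<in>F. C b) \<in> sets M" using C that by (intro sets.finite_INT) auto
    then show ?thesis by (auto simp: D_def)
  qed (simp add: D_def)
  have DN: "D F \<in> sets M" if "F \<in> N b" for F b
    using that D uF unfolding N_def by blast
  have "\<forall>b. \<exists>G. countable G \<and> G \<subseteq> N b \<and> (\<forall>F\<in>N b. measure M (D F - (\<Union>F'\<in>G. D F')) = 0)"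
  proof
    fix b
    obtain G where "countable G" "G \<subseteq> N b" "\<And>F. F \<in> N b \<Longrightarrow> measure M (D F - (\<Union>F'\<in>G. D F')) = 0"
      using countable_essential_union[of "N b" D] DN by blast
    then show "\<exists>G. countable G \<and> G \<subseteq> N b \<and> (\<forall>F\<in>N b. measure M (D F - (\<Union>F'\<in>G. D F')) = 0)" by blast
  qed
  from choice[OF this] obtain \<F> where "\<forall>b. countable (\<F> b) \<and> \<F> b \<subseteq> N b \<and>
      (\<forall>F\<in>N b. measure M (D F - (\<Union>F'\<in>\<F> b. D F')) = 0)" ..
  then have \<F>: "\<And>b. countable (\<F> b)" "\<And>b. \<F> b \<subseteq> N b"
    "\<And>b F. F \<in> N b \<Longrightarrow> measure M (D F - (\<Union>F'\<in>\<F> b. D F')) = 0" by simp_all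
  obtain T \<G> where T: "kap_unbounded T" "\<And>b. b \<in> T \<Longrightarrow> \<F> b = \<G>"
  proof (rule pressing_down)
    show "countable (\<F> b)" for b by (rule \<F>)
    show "finite F \<and> F \<subseteq> underS kap b" if "F \<in> \<F> b" for b F
      using that \<F>(2)[of b] by (auto simp: N_def)
  qed (rule that)
  have TF: "T \<subseteq> Field kap" using T(1) by (simp add: kap_unbounded_def)
  define Z where "Z = (\<Union>F\<in>\<G>. D F)"
  have Gs: "countable \<G>" "\<G> \<subseteq> N b" if "b \<in> T" for b using \<F>(1,2)[of b] T(2)[OF that] by auto
  have Zs: "Z \<in> sets M" if "b \<in> T" for b
    using Gs[OF that] DN unfolding Z_def by (intro sets.countable_UN'') auto
  have ZC: "measure M (Z \<inter> C b) = 0" if b: "b \<in> T" for b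
  proof -
    have "(\<Union>F\<in>\<G>. D F \<inter> C b) \<in> null_sets M"
    proof (rule null_sets_UN')
      fix F assume "F \<in> \<G>"
      then have "F \<in> N b" using Gs[OF b] by blast
      then show "D F \<inter> C b \<in> null_sets M"
        using DN[of F b] C b TF by (auto simp: N_def null_sets_def emeasure_eq_measure)
    qed (rule Gs[OF b])
    then have "emeasure M (\<Union>F\<in>\<G>. D F \<inter> C b) = 0" by blast
    moreover have "(\<Union>F\<in>\<G>. D F \<inter> C b) = Z \<inter> C b" unfolding Z_def by blast
    ultimately show ?thesis by (simp add: emeasure_eq_measure)
  qed
  \<comment> \<open>The second conjunct drives the induction. If the largest \<open>b\<close> of
    \<open>F\<close> killed \<open>D (F - {b})\<close>, that set would lie in \<open>Z\<close> up to
    a null set; as it also meets \<open>Z\<close> in a null set, it would be null.\<close>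
  have main: "0 < measure M (D F) \<and> measure M (D F \<inter> Z) = 0"
    if "finite F" "F \<subseteq> T" "F \<noteq> {}" for F
    using that
  proof (induction "card F" arbitrary: F rule: less_induct)
    case less
    obtain b where b: "b \<in> F" "\<And>a. a \<in> F \<Longrightarrow> a = b \<or> a \<in> underS kap b"
    proof -
      have "\<exists>b\<in>F. \<forall>a\<in>F. (a, b) \<in> kap"
        using less.prems(1,3,2)
      proof (induction F rule: finite_ne_induct)
        case (singleton x)
        then show ?case using TF wo_rel.REFL[OF kwr] unfolding refl_on_def by blast
      next
        case (insert x F)
        then obtain b where "b \<in> F" "\<forall>a\<in>F. (a, b) \<in> kap" by auto
        moreover have "(x, b) \<in> kap \<or> (b, x) \<in> kap" "(x, x) \<in> kap"
          using insert.prems \<open>b \<in> F\<close> TF wo_rel.TOTALS[OF kwr] wo_rel.REFL[OF kwr] unfolding refl_on_def by blast+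
        ultimately show ?case using wo_rel.TRANS[OF kwr] unfolding trans_def by (metis insert_iff)
      qed
      then show thesis using that unfolding underS_def by blast
    qed
    have bT: "b \<in> T" and bF: "b \<in> Field kap" using b(1) less.prems TF by auto
    let ?F = "F - {b}"
    have DF: "D F = D ?F \<inter> C b" using b(1) by (auto simp: D_def)
    have sF: "D F \<in> sets M" "D ?F \<in> sets M" using less.prems TF by (auto intro!: D)
    have null: "measure M (D F \<inter> Z) = 0"
    proof -
      have "measure M (D F \<inter> Z) \<le> measure M (Z \<inter> C b)"
        using Zs[OF bT] C[OF bF] DF by (intro finite_measure_mono) auto
      then show ?thesis using ZC[OF bT] by (simp add: measure_le_0_iff)
    qed
    have "0 < measure M (D F)"
    proof (cases "?F = {}")
      case True
      then have "D F = C b" using DF sets.sets_into_space[OF C[OF bF]] by (auto simp: D_def)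
      then show ?thesis using pos[OF bF] by simp
    next
      case False
      have "card ?F < card F" using less.prems b(1) by (meson card_Diff1_less)
      then have IH: "0 < measure M (D ?F)" "measure M (D ?F \<inter> Z) = 0"
        using less.hyps[of ?F] less.prems False by auto
      show ?thesis
      proof (rule ccontr)
        assume "\<not> ?thesis"
        then have "measure M (D ?F \<inter> C b) = 0" using DF by (simp add: zero_less_measure_iff)
        then have "?F \<in> N b" using less.prems b(2) by (auto simp: N_def)
        from \<F>(3)[OF this] have "measure M (D ?F - Z) = 0" using T(2)[OF bT] by (simp add: Z_def)
        moreover have "measure M (D ?F) = measure M (D ?F - Z) + measure M (D ?F \<inter> Z)"
          using sF(2) Zs[OF bT] by (subst finite_measure_Union[symmetric]) (auto intro!: arg_cong[of _ _ "measure M"])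
        ultimately show False using IH by simp
      qed
    qed
    with null show ?case by blast
  qed
  show thesis
  proof (rule that[OF T(1)])
    fix F assume "finite F" "F \<subseteq> T" "F \<noteq> {}"
    from main[OF this] show "(\<Inter>b\<in>F. C b) \<noteq> {}" by (auto simp: D_def)
  qed
qed


section \<open>Ultrafilters\<close>

definition ultra :: "'i filter \<Rightarrow> bool" where
  "ultra F \<longleftrightarrow> F \<noteq> bot \<and> (\<forall>P. eventually P F \<or> eventually (\<lambda>x. \<not> P x) F)"

lemma ultra_not: "ultra F \<Longrightarrow> eventually (\<lambda>x. \<not> P x) F \<longleftrightarrow> \<not> eventually P F"
  unfolding ultra_def using eventually_conj[of P F "\<lambda>x. \<not> P x"]
  by (auto simp: trivial_limit_def)

lemma ultra_disj:
  assumes "ultra F"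
  shows "eventually (\<lambda>x. P x \<or> Q x) F \<longleftrightarrow> eventually P F \<or> eventually Q F"
proof -
  have "eventually (\<lambda>x. \<not> (P x \<or> Q x)) F \<longleftrightarrow> \<not> eventually P F \<and> \<not> eventually Q F"
    by (simp add: eventually_conj_iff ultra_not[OF assms])
  then show ?thesis using ultra_not[OF assms, of "\<lambda>x. P x \<or> Q x"] by blast
qed

lemma ultra_eventually_const: "ultra F \<Longrightarrow> eventually (\<lambda>x. P) F \<longleftrightarrow> P"
  unfolding ultra_def by (cases P) (auto simp: trivial_limit_def)

lemma ultra_ex: "ultra F \<Longrightarrow> eventually P F \<Longrightarrow> \<exists>x. P x"
  unfolding ultra_def using eventually_happens' by blast

text \<open>Finer filters are smaller in the order on filters, so Zorn's lemma is applied downwards.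
  The infimum of a nonempty chain of proper filters is proper because a chain is a filter
  base.\<close>

lemma ultra_exists:
  assumes "F \<noteq> bot"
  obtains G where "ultra G" "G \<le> F"
proof -
  let ?A = "{G. G \<noteq> bot \<and> G \<le> F}"
  have "\<exists>m\<in>?A. \<forall>a\<in>?A. a \<le> m \<longrightarrow> a = m"
  proof (rule predicate_Zorn)
    show "partial_order_on ?A (relation_of (\<lambda>a b. b \<le> a) ?A)"
      by (auto simp: partial_order_on_def preorder_on_def refl_on_def trans_def antisym_def
          relation_of_def)
  next
    fix C assume C: "C \<in> Chains (relation_of (\<lambda>a b. b \<le> a) ?A)"
    show "\<exists>u\<in>?A. \<forall>a\<in>C. u \<le> a"
    proof (cases "C = {}")
      case True
      then show ?thesis using assms by auto
    next
      case False
      have sub: "C \<subseteq> ?A" and lin: "\<And>a b. a \<in> C \<Longrightarrow> b \<in> C \<Longrightarrow> a \<le> b \<or> b \<le> a"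
        using C by (auto simp: Chains_def relation_of_def)
      have "eventually (\<lambda>x. False) (Inf C) \<longleftrightarrow> (\<exists>b\<in>C. eventually (\<lambda>x. False) b)"
      proof (rule eventually_Inf_base[OF False])
        fix a b assume "a \<in> C" "b \<in> C"
        then show "\<exists>x\<in>C. x \<le> inf a b" using lin[of a b] by (metis inf.absorb1 inf.absorb2 order_refl)
      qed
      then have "Inf C \<noteq> bot"
        using sub by (auto simp: trivial_limit_def)
      moreover have "Inf C \<le> F"
        using False sub Inf_lower[of _ C] by (metis (no_types, lifting) equals0I mem_Collect_eq order_trans subsetD)
      ultimately show ?thesis by (auto intro!: bexI[of _ "Inf C"] Inf_lower)
    qed
  qed
  then obtain m where m: "m \<noteq> bot" "m \<le> F"
    and max: "\<And>a. a \<noteq> bot \<Longrightarrow> a \<le> m \<Longrightarrow> a = m"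
    by (auto intro: order_trans)
  have "eventually P m \<or> eventually (\<lambda>x. \<not> P x) m" for P
  proof (cases "eventually (\<lambda>x. \<not> P x) m")
    case False
    then have "inf m (principal (Collect P)) \<noteq> bot"
      by (auto simp: trivial_limit_def eventually_inf_principal)
    then have "inf m (principal (Collect P)) = m" by (intro max) auto
    then have "m \<le> principal (Collect P)" by (metis inf.cobounded2)
    then show ?thesis by (simp add: le_principal)
  qed simp
  then show ?thesis using m that by (auto simp: ultra_def)
qed

lemma ultra_extends:
  assumes "\<And>X. finite X \<Longrightarrow> X \<subseteq> B \<Longrightarrow> \<Inter>X \<noteq> {}"
  obtains W where "ultra W" "\<And>A. A \<in> B \<Longrightarrow> eventually (\<lambda>x. x \<in> A) W"
proof -
  have "(INF A\<in>B. principal A) \<noteq> bot"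
  proof (rule INF_filter_not_bot)
    fix X assume "X \<subseteq> B" "finite X"
    then show "(INF A\<in>X. principal A) \<noteq> bot"
      using assms[of X] INF_principal_finite[of X id] by (simp add: principal_eq_bot_iff)
  qed
  then obtain W where W: "ultra W" "W \<le> (INF A\<in>B. principal A)" by (rule ultra_exists)
  have "eventually (\<lambda>x. x \<in> A) W" if "A \<in> B" for A
    using order_trans[OF W(2) INF_lower[OF that]] by (simp add: le_principal)
  then show ?thesis using that W(1) by blast
qed

lemma ultra_tendsto_compact:
  fixes f :: "'i \<Rightarrow> 'a::topological_space"
  assumes "ultra F" "compact S" "\<And>x. f x \<in> S"
  obtains l where "l \<in> S" "(f \<longlongrightarrow> l) F"
proof -
  have "filtermap f F \<noteq> bot" using assms(1) by (simp add: filtermap_bot_iff ultra_def)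
  then obtain l where l: "l \<in> S" "inf (nhds l) (filtermap f F) \<noteq> bot"
    using assms(2,3) unfolding compact_filter by (auto simp: eventually_filtermap)
  have "eventually (\<lambda>x. f x \<in> A) F" if "open A" "l \<in> A" for A
  proof (rule ccontr)
    assume "\<not> ?thesis"
    then have "eventually (\<lambda>x. f x \<notin> A) F" by (simp add: ultra_not[OF assms(1)])
    moreover have "eventually (\<lambda>y. y \<in> A) (nhds l)"
      using that by (simp add: eventually_nhds_in_open)
    ultimately have "eventually (\<lambda>y. False) (inf (nhds l) (filtermap f F))"
      unfolding eventually_inf eventually_filtermap
      by (intro exI[of _ "\<lambda>y. y \<in> A"] exI[of _ "\<lambda>y. y \<notin> A"]) auto
    then show False using l(2) by (simp add: trivial_limit_def)
  qed
  then have "(f \<longlongrightarrow> l) F" by (simp add: tendsto_def)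
  then show ?thesis using that l(1) by blast
qed

lemma ultra_infinite:
  fixes h :: "'i \<Rightarrow> nat"
  assumes "ultra F" "\<And>m. \<not> eventually (\<lambda>x. h x = m) F"
  shows "eventually (\<lambda>x. n \<le> h x) F"
proof (induction n)
  case (Suc n)
  have "eventually (\<lambda>x. h x \<noteq> n) F" using assms by (simp add: ultra_not)
  with Suc show ?case by eventually_elim simp
qed simp


section \<open>A generic ultrafilter\<close>

text \<open>In an index \<open>w\<close>, the coordinate \<open>snd w k\<close> prescribes for each \<open>n\<close> a candidate for a small subset of
  \<open>{1..n}\<close>; \<open>cover\<close> replaces candidates that are too large by the empty set.\<close>

type_synonym 'k idx = "nat \<times> ('k \<Rightarrow> nat \<Rightarrow> nat set)"

text \<open>The natural number in front is compared whatever \<open>J\<close> is, so a function of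
  that number alone has empty support and is available at every stage.\<close>

definition agree :: "'k set \<Rightarrow> 'k idx \<Rightarrow> 'k idx \<Rightarrow> bool" where
  "agree J v w \<longleftrightarrow> fst v = fst w \<and> (\<forall>j\<in>J. snd v j = snd w j)"

definition dep :: "'k set \<Rightarrow> ('k idx \<Rightarrow> 'a) \<Rightarrow> bool" where
  "dep J f \<longleftrightarrow> (\<forall>v w. agree J v w \<longrightarrow> f v = f w)"

definition cover :: "(nat \<Rightarrow> nat set) \<Rightarrow> nat \<Rightarrow> nat set" where
  "cover x h = (if finite (x h) \<and> 2 * card (x h) \<le> h then x h else {})"

definition below :: "'k rel \<Rightarrow> 'k \<Rightarrow> 'k set" where
  "below R j = {i. (i, j) \<in> R}"

definition cover_sets :: "'k rel \<Rightarrow> 'k \<Rightarrow> 'k idx filter \<Rightarrow> 'k idx set set" where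
  "cover_sets R j F = {{w. f w \<in> cover (snd w j) (h w)} | f h.
     dep (below R j) f \<and> dep (below R j) h \<and> (\<forall>n. eventually (\<lambda>w. n \<le> h w) F)}"

text \<open>Each stage \<open>j\<close> passes on what \<open>u j\<close> decides about sets of
  earlier coordinates, together with the requirements on coordinate \<open>j\<close> for those
  \<open>h\<close> that \<open>u j\<close> regards as infinite. What \<open>u j\<close> says about
  coordinate \<open>j\<close> and later ones is dropped, as it could contradict the
  requirements.\<close>

definition base :: "'k rel \<Rightarrow> ('k \<Rightarrow> 'k idx filter) \<Rightarrow> 'k set \<Rightarrow> 'k idx set set" where
  "base R u S = range (\<lambda>n. {w. n \<le> fst w}) \<union>
     (\<Union>j\<in>S. {A. eventually (\<lambda>w. w \<in> A) (u j) \<and> dep (below R j) (\<lambda>w. w \<in> A)} \<union> cover_sets R j (u j))"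

lemma dep_mono: "dep J f \<Longrightarrow> J \<subseteq> L \<Longrightarrow> dep L f"
  unfolding dep_def agree_def by blast

lemma finite_cover[simp]: "finite (cover x h)"
  by (simp add: cover_def)

lemma card_cover: "2 * card (cover x h) \<le> h"
  by (simp add: cover_def)

lemma cover_sets_dep:
  assumes "A \<in> cover_sets R j F"
  shows "dep (insert j (below R j)) (\<lambda>w. w \<in> A)"
proof -
  obtain f h where A: "A = {w. f w \<in> cover (snd w j) (h w)}"
    and d: "dep (below R j) f" "dep (below R j) h"
    using assms unfolding cover_sets_def by blast
  show ?thesis
    unfolding dep_def
  proof (intro allI impI)
    fix v w :: "'a idx" assume "agree (insert j (below R j)) v w"
    then have "agree (below R j) v w" "snd v j = snd w j" by (auto simp: agree_def)
    then show "(v \<in> A) = (w \<in> A)" using d unfolding A dep_def by (metis (lifting) mem_Collect_eq)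
  qed
qed

lemma exists_max_strict:
  assumes "finite J" "J \<noteq> {}" "J \<subseteq> K" "trans R"
    and "\<And>i j. i \<in> K \<Longrightarrow> j \<in> K \<Longrightarrow> i = j \<or> (i, j) \<in> R \<or> (j, i) \<in> R"
  shows "\<exists>m\<in>J. \<forall>i\<in>J. i = m \<or> (i, m) \<in> R"
  using assms(1-3)
proof (induction J rule: finite_ne_induct)
  case (insert x J)
  then obtain m where "m \<in> J" "\<forall>i\<in>J. i = m \<or> (i, m) \<in> R" by auto
  moreover have "x = m \<or> (x, m) \<in> R \<or> (m, x) \<in> R" using insert.prems \<open>m \<in> J\<close> assms(5) by auto
  ultimately show ?case using \<open>trans R\<close>[THEN transD] by (metis insert_iff)
qed auto

text \<open>Coordinate \<open>j\<close> is still free: changing it alters neither membership in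
  \<open>B\<close> nor the values of the functions involved, which depend on earlier coordinates. At
  an index where all the lengths are large, it is redefined so as to contain the finitely many
  points demanded.\<close>

lemma cover_sets_fip:
  assumes F: "ultra F" and B: "eventually (\<lambda>w. w \<in> B) F" "dep (below R j) (\<lambda>w. w \<in> B)"
    and G: "finite G" "G \<subseteq> cover_sets R j F" and irrefl: "(j, j) \<notin> R"
  shows "\<exists>w\<in>B. \<forall>A\<in>G. w \<in> A"
proof -
  have "\<forall>A\<in>G. \<exists>f h. A = {w. f w \<in> cover (snd w j) (h w)} \<and>
     dep (below R j) f \<and> dep (below R j) h \<and> (\<forall>n. eventually (\<lambda>w. n \<le> h w) F)"
  proof
    fix A assume "A \<in> G"
    with G(2) have "A \<in> cover_sets R j F" by blast
    then show "\<exists>f h. A = {w. f w \<in> cover (snd w j) (h w)} \<and>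
     dep (below R j) f \<and> dep (below R j) h \<and> (\<forall>n. eventually (\<lambda>w. n \<le> h w) F)"
      by (simp add: cover_sets_def)
  qed
  from bchoice[OF this] obtain f where f: "\<forall>A\<in>G. \<exists>h. A = {w. f A w \<in> cover (snd w j) (h w)} \<and>
     dep (below R j) (f A) \<and> dep (below R j) h \<and> (\<forall>n. eventually (\<lambda>w. n \<le> h w) F)" ..
  from bchoice[OF f] obtain h where fh: "\<And>A. A \<in> G \<Longrightarrow> A = {w. f A w \<in> cover (snd w j) (h A w)}"
    and df: "\<And>A. A \<in> G \<Longrightarrow> dep (below R j) (f A)"
    and dh: "\<And>A. A \<in> G \<Longrightarrow> dep (below R j) (h A)"
    and inf: "\<And>A n. A \<in> G \<Longrightarrow> eventually (\<lambda>w. n \<le> h A w) F"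
    by blast
  have "eventually (\<lambda>w. \<forall>A\<in>G. 2 * card G \<le> h A w) F"
    using inf G(1) by (simp add: eventually_ball_finite)
  then have "eventually (\<lambda>w. w \<in> B \<and> (\<forall>A\<in>G. 2 * card G \<le> h A w)) F"
    using B(1) by (simp add: eventually_conj_iff)
  then obtain v where v: "v \<in> B" "\<And>A. A \<in> G \<Longrightarrow> 2 * card G \<le> h A v"
    using ultra_ex[OF F] by blast
  \<comment> \<open>\<open>x n\<close> gathers the points demanded by the requirements of length
    \<open>n\<close>. There are at most \<open>card G\<close> of them, hence at most half of
    \<open>n\<close> by the choice of \<open>v\<close>; any other fixed proportion strictly between
    0 and 1 could replace one half.\<close>
  define x where "x = (\<lambda>n::nat. (\<lambda>A. f A v) ` {A \<in> G. h A v = n})"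
  define w where "w = (fst v, (snd v)(j := x))"
  have ag: "agree (below R j) v w"
    using irrefl by (auto simp: w_def agree_def below_def)
  have "w \<in> B" using v(1) B(2) ag unfolding dep_def by blast
  moreover have "w \<in> A" if A: "A \<in> G" for A
  proof -
    have "f A w = f A v" "h A w = h A v"
      using df[OF A] dh[OF A] ag unfolding dep_def by metis+
    moreover have "2 * card (x (h A v)) \<le> h A v"
    proof -
      have "card (x (h A v)) \<le> card {A' \<in> G. h A' v = h A v}"
        unfolding x_def using G(1) by (intro card_image_le) auto
      also have "\<dots> \<le> card G" using G(1) by (intro card_mono) auto
      finally show ?thesis using v(2)[OF A] by simp
    qed
    moreover have "f A v \<in> x (h A v)" "finite (x (h A v))"
      using A G(1) by (auto simp: x_def)
    ultimately show ?thesis by (subst fh[OF A]) (simp add: cover_def w_def)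
  qed
  ultimately show ?thesis by blast
qed

text \<open>Everything is reduced to the last stage \<open>m\<close> involved in \<open>G\<close>.
  The members of \<open>G\<close> that are not requirements at \<open>m\<close> depend on
  coordinates below \<open>m\<close> and hold almost everywhere for \<open>u m\<close>; their
  intersection \<open>B\<close> is a set of indices at which coordinate \<open>m\<close> can still
  be adjusted.\<close>

lemma base_fip:
  assumes "wf R" "trans R" "S \<subseteq> K"
    and tot: "\<And>i j. i \<in> K \<Longrightarrow> j \<in> K \<Longrightarrow> i = j \<or> (i, j) \<in> R \<or> (j, i) \<in> R"
    and u: "\<And>j. j \<in> S \<Longrightarrow> ultra (u j)"
    and ub: "\<And>j A. j \<in> S \<Longrightarrow> A \<in> base R u (below R j) \<Longrightarrow> eventually (\<lambda>w. w \<in> A) (u j)"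
    and G: "finite G" "G \<subseteq> base R u S"
  shows "\<Inter>G \<noteq> {}"
proof -
  let ?D = "\<lambda>j. {A. eventually (\<lambda>w. w \<in> A) (u j) \<and> dep (below R j) (\<lambda>w. w \<in> A)}"
  let ?N = "range (\<lambda>n. {w :: 'a idx. n \<le> fst w})"
  have depN: "dep J (\<lambda>w. w \<in> A)" if "A \<in> ?N" for A and J :: "'a set"
    using that by (auto simp: dep_def agree_def)
  have "\<exists>j. j \<in> S \<and> A \<in> ?D j \<union> cover_sets R j (u j)" if "A \<in> G - ?N" for A
  proof -
    have "A \<in> base R u S" using that G(2) by blast
    then show ?thesis using that unfolding base_def Un_iff UN_iff by blast
  qed
  then have "\<forall>A\<in>G - ?N. \<exists>j. j \<in> S \<and> A \<in> ?D j \<union> cover_sets R j (u j)" by blast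
  from bchoice[OF this] obtain ix where ix: "\<And>A. A \<in> G \<Longrightarrow> A \<notin> ?N \<Longrightarrow> ix A \<in> S \<and> A \<in> ?D (ix A) \<union> cover_sets R (ix A) (u (ix A))"
    by blast
  define J where "J = ix ` (G - ?N)"
  have fJ: "finite J" and JS: "J \<subseteq> S" using G(1) ix by (auto simp: J_def)
  show ?thesis
  proof (cases "J = {}")
    case True
    then have "\<forall>A\<in>G. \<exists>n. A = {w. n \<le> fst w}" by (auto simp: J_def)
    from bchoice[OF this] obtain n where n: "\<And>A. A \<in> G \<Longrightarrow> A = {w. n A \<le> fst w}" by blast
    have "(Max (n ` G), undefined) \<in> A" if "A \<in> G" for A
    proof -
      have "n A \<le> Max (n ` G)" using that G(1) by simp
      then have "(Max (n ` G), undefined) \<in> {w. n A \<le> fst w}" by simp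
      with n[OF that] show ?thesis by (rule ssubst)
    qed
    then show ?thesis by blast
  next
    case False
    obtain m where m: "m \<in> J" "\<And>i. i \<in> J \<Longrightarrow> i = m \<or> (i, m) \<in> R"
      using exists_max_strict[OF fJ False order_trans[OF JS \<open>S \<subseteq> K\<close>] \<open>trans R\<close> tot] by metis
    have mS: "m \<in> S" using m JS by blast
    define B where "B = \<Inter>(G - cover_sets R m (u m))"
    have *: "A \<in> ?D m" if A: "A \<in> G" "A \<notin> cover_sets R m (u m)" for A
    proof (cases "A \<in> ?N")
      case True
      then have "A \<in> base R u (below R m)" by (auto simp: base_def)
      then show ?thesis using ub[OF mS] depN[OF True] by blast
    next
      case NN: False
      then have iJ: "ix A \<in> J" using A by (auto simp: J_def)
      show ?thesis
      proof (cases "ix A = m")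
        case True
        then show ?thesis using ix[OF A(1) NN] A(2) by auto
      next
        case False
        then have lt: "(ix A, m) \<in> R" using m(2) iJ by blast
        then have b: "insert (ix A) (below R (ix A)) \<subseteq> below R m"
          using \<open>trans R\<close>[THEN transD] by (auto simp: below_def)
        have "A \<in> base R u (below R m)"
        proof -
          have "ix A \<in> below R m" using lt by (simp add: below_def)
          then show ?thesis unfolding base_def
            by (rule UnI2[OF UN_I]) (use ix[OF A(1) NN] in simp)
        qed
        moreover have "dep (below R m) (\<lambda>w. w \<in> A)"
        proof -
          have "dep (insert (ix A) (below R (ix A))) (\<lambda>w. w \<in> A)"
            using ix[OF A(1) NN] cover_sets_dep[of A R "ix A" "u (ix A)"]
              dep_mono[of "below R (ix A)" "\<lambda>w. w \<in> A" "insert (ix A) (below R (ix A))"]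
            by auto
          then show ?thesis using b by (rule dep_mono)
        qed
        ultimately show ?thesis using ub[OF mS] by blast
      qed
    qed
    have "eventually (\<lambda>w. \<forall>A\<in>G - cover_sets R m (u m). w \<in> A) (u m)"
      using * G(1) by (auto intro!: eventually_ball_finite)
    then have B1: "eventually (\<lambda>w. w \<in> B) (u m)" by (simp add: B_def)
    have B2: "dep (below R m) (\<lambda>w. w \<in> B)"
      using * unfolding B_def dep_def by (simp add: Ball_def)
    have "\<exists>w\<in>B. \<forall>A\<in>G \<inter> cover_sets R m (u m). w \<in> A"
      by (rule cover_sets_fip[OF u[OF mS] B1 B2]) (use G(1) \<open>wf R\<close> in auto)
    then show ?thesis unfolding B_def by blast
  qed
qed

lemma base_cong: "(\<And>j. j \<in> S \<Longrightarrow> u j = v j) \<Longrightarrow> base R u S = base R v S"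
  unfolding base_def by simp

text \<open>The ultrafilter at stage \<open>j\<close> decides which hypernaturals depending on earlier coordinates are
  infinite; only then can the requirements on coordinate \<open>j\<close> be formulated.\<close>

lemma generic_ultrafilter:
  assumes "wf R" "trans R" "R \<subseteq> K \<times> K"
    and tot: "\<And>i j. i \<in> K \<Longrightarrow> j \<in> K \<Longrightarrow> i = j \<or> (i, j) \<in> R \<or> (j, i) \<in> R"
  obtains W where "ultra W" "\<And>n. eventually (\<lambda>w. n \<le> fst w) W"
    "\<And>j f h. j \<in> K \<Longrightarrow> dep (below R j) f \<Longrightarrow> dep (below R j) h \<Longrightarrow>
      (\<And>n. eventually (\<lambda>w. n \<le> h w) W) \<Longrightarrow> eventually (\<lambda>w. f w \<in> cover (snd w j) (h w)) W"
proof -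
  define S where "S = (\<lambda>u j W. ultra W \<and> (\<forall>A\<in>base R u (below R j). eventually (\<lambda>w. w \<in> A) W))"
  define u where "u = wfrec R (\<lambda>u j. SOME W. S u j W)"
  have ueq: "u j = (SOME W. S u j W)" for j
  proof -
    have "u j = (SOME W. S (cut u R j) j W)"
      unfolding u_def by (subst wfrec[OF \<open>wf R\<close>]) simp
    also have "S (cut u R j) j = S u j"
      unfolding S_def by (subst base_cong[of _ "cut u R j" u]) (auto simp: below_def cut_apply)
    finally show ?thesis .
  qed
  have below_K: "below R j \<subseteq> K" for j using assms(3) by (auto simp: below_def)
  have Su: "S u j (u j)" for j
    using \<open>wf R\<close>
  proof (induction j rule: wf_induct_rule)
    case (less j)
    obtain W where "ultra W" "\<And>A. A \<in> base R u (below R j) \<Longrightarrow> eventually (\<lambda>x. x \<in> A) W"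
    proof (rule ultra_extends)
      fix X assume "finite X" "X \<subseteq> base R u (below R j)"
      then show "\<Inter>X \<noteq> {}"
        by (intro base_fip[OF assms(1,2) below_K tot])
          (use less in \<open>auto simp: S_def below_def\<close>)
    qed blast
    then have "S u j W" by (simp add: S_def)
    then show ?case by (subst ueq) (rule someI)
  qed
  obtain W where W: "ultra W" "\<And>A. A \<in> base R u K \<Longrightarrow> eventually (\<lambda>x. x \<in> A) W"
  proof (rule ultra_extends)
    fix X assume "finite X" "X \<subseteq> base R u K"
    then show "\<Inter>X \<noteq> {}"
      by (intro base_fip[OF assms(1,2) order_refl tot]) (use Su in \<open>auto simp: S_def\<close>)
  qed blast
  show thesis
  proof (rule that[OF W(1)])
    show "eventually (\<lambda>w. n \<le> fst w) W" for n
      using W(2)[of "{w. n \<le> fst w}"] by (auto simp: base_def)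
  next
    fix j and f h :: "'a idx \<Rightarrow> nat"
    assume j: "j \<in> K" and d: "dep (below R j) f" "dep (below R j) h"
      and inf: "\<And>n. eventually (\<lambda>w. n \<le> h w) W"
    \<comment> \<open>A bound on \<open>h\<close> is a statement about coordinates below
      \<open>j\<close>. Had \<open>u j\<close> accepted it, the base would have handed it on to
      \<open>W\<close>; so an \<open>h\<close> that is infinite for \<open>W\<close> was already
      infinite at stage \<open>j\<close>.\<close>
    have "eventually (\<lambda>w. n \<le> h w) (u j)" for n
    proof (rule ccontr)
      assume "\<not> ?thesis"
      then have "eventually (\<lambda>w. w \<in> {w. \<not> n \<le> h w}) (u j)"
        using Su[of j] unfolding S_def by (auto simp: ultra_not)
      moreover have "dep (below R j) (\<lambda>w. w \<in> {w. \<not> n \<le> h w})"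
        using d(2) unfolding dep_def by (metis (lifting) mem_Collect_eq)
      ultimately have "{w. \<not> n \<le> h w} \<in> base R u K" using j by (auto simp: base_def)
      from W(2)[OF this] inf[of n] show False by (simp add: ultra_not[OF W(1)] del: not_le)
    qed
    then have "{w. f w \<in> cover (snd w j) (h w)} \<in> cover_sets R j (u j)"
      using d by (auto simp: cover_sets_def)
    then have "{w. f w \<in> cover (snd w j) (h w)} \<in> base R u K" using j by (auto simp: base_def)
    from W(2)[OF this] show "eventually (\<lambda>w. f w \<in> cover (snd w j) (h w)) W" by simp
  qed
qed


section \<open>The superstructure\<close>

context superstructure
begin

abbreviation V :: "'v set" where "V \<equiv> std_univ num mk"
abbreviation mem :: "'v \<Rightarrow> 'v \<Rightarrow> bool" where "mem \<equiv> std_mem num mk"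
abbreviation lev :: "nat \<Rightarrow> 'v set" where "lev \<equiv> vlev num mk"

lemma lev_mono: "m \<le> n \<Longrightarrow> lev m \<subseteq> lev n"
  by (rule lift_Suc_mono_le[of lev]) auto

lemma lev_V: "x \<in> lev n \<Longrightarrow> x \<in> V"
  by (auto simp: std_univ_def)

lemma mk_lev: "A \<subseteq> lev n \<Longrightarrow> mk A \<in> lev (Suc n)"
  by simp

lemma vboundedI: "A \<subseteq> lev n \<Longrightarrow> vbounded num mk A"
  by (auto simp: vbounded_def)

lemma mk_V: "vbounded num mk A \<Longrightarrow> mk A \<in> V"
  unfolding vbounded_def using mk_lev lev_V by blast

lemma mk_eq_iff: "vbounded num mk A \<Longrightarrow> vbounded num mk B \<Longrightarrow> mk A = mk B \<longleftrightarrow> A = B"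
  using inj_mk by (auto simp: inj_on_def)

lemma mem_mk: "vbounded num mk A \<Longrightarrow> mem x (mk A) \<longleftrightarrow> x \<in> A"
  unfolding std_mem_def using mk_eq_iff by blast

lemma num_lev: "num n \<in> lev m"
  using lev_mono[of 0 m] by auto

lemma num_V: "num n \<in> V"
  using num_lev lev_V by blast

lemma not_mem_num: "\<not> mem x (num n)"
  unfolding std_mem_def using mk_not_num by (metis rangeI)

text \<open>Transitivity of the levels; it is what keeps members of elements of the truncation
  inside the truncation.\<close>

lemma mem_lev: "mem x y \<Longrightarrow> y \<in> lev n \<Longrightarrow> x \<in> lev n"
proof (induction n)
  case 0
  then show ?case using not_mem_num by auto
next
  case (Suc n)
  show ?case
  proof (cases "y \<in> lev n")
    case False
    then obtain A where "A \<subseteq> lev n" "y = mk A" using Suc.prems(2) by auto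
    then show ?thesis using mem_mk[OF vboundedI] Suc.prems(1) by auto
  qed (use Suc in auto)
qed

lemma mem_V: "mem x y \<Longrightarrow> x \<in> V"
  unfolding std_mem_def vbounded_def using lev_V by blast

lemma V_set: "y \<in> V \<Longrightarrow> y \<notin> range num \<Longrightarrow> \<exists>A. vbounded num mk A \<and> y = mk A"
proof -
  have "y \<in> lev n \<Longrightarrow> y \<notin> range num \<Longrightarrow> \<exists>A. vbounded num mk A \<and> y = mk A" for n
    by (induction n) (auto intro: vboundedI)
  then show "y \<in> V \<Longrightarrow> y \<notin> range num \<Longrightarrow> ?thesis" by (auto simp: std_univ_def)
qed

lemma set_ext:
  assumes "y \<in> V" "y' \<in> V" "y \<notin> range num" "y' \<notin> range num" "\<And>x. mem x y \<longleftrightarrow> mem x y'"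
  shows "y = y'"
proof -
  obtain A B where "vbounded num mk A" "y = mk A" "vbounded num mk B" "y' = mk B"
    using V_set assms(1-4) by blast
  moreover from this have "A = B" using assms(5) mem_mk by blast
  ultimately show ?thesis by simp
qed

lemma vbounded_pair: "x \<in> V \<Longrightarrow> y \<in> V \<Longrightarrow> vbounded num mk {x, y}"
proof -
  assume "x \<in> V" "y \<in> V"
  then obtain m n where "x \<in> lev m" "y \<in> lev n" by (auto simp: std_univ_def)
  then have "{x, y} \<subseteq> lev (max m n)" using lev_mono[of m "max m n"] lev_mono[of n "max m n"] by auto
  then show ?thesis by (rule vboundedI)
qed

lemma vbounded_singleton: "x \<in> V \<Longrightarrow> vbounded num mk {x}"
  using vbounded_pair[of x x] by simp

lemma vbounded_nums: "vbounded num mk (num ` A)"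
  by (rule vboundedI[of _ 0]) auto

lemma vpair_lev: "x \<in> lev n \<Longrightarrow> y \<in> lev n \<Longrightarrow> vpair x y \<in> lev (Suc (Suc n))"
  unfolding vpair_def by (intro mk_lev) (auto simp del: vlev.simps intro!: mk_lev)

lemma vpair_V: "x \<in> V \<Longrightarrow> y \<in> V \<Longrightarrow> vpair x y \<in> V"
  unfolding vpair_def by (intro mk_V vbounded_pair vbounded_singleton)

lemma vpair_eq_iff:
  assumes "x \<in> V" "y \<in> V" "x' \<in> V" "y' \<in> V"
  shows "vpair x y = vpair x' y' \<longleftrightarrow> x = x' \<and> y = y'"
proof -
  note b = assms[THEN vbounded_singleton] vbounded_pair[OF assms(1,2)] vbounded_pair[OF assms(3,4)]
  have "vpair x y = vpair x' y' \<longleftrightarrow> {mk {x}, mk {x, y}} = {mk {x'}, mk {x', y'}}"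
    unfolding vpair_def by (intro mk_eq_iff vbounded_pair mk_V b)
  also have "\<dots> \<longleftrightarrow> x = x' \<and> y = y'"
    unfolding doubleton_eq_iff by (auto simp: mk_eq_iff b doubleton_eq_iff)
  finally show ?thesis .
qed

lemma rcut_lev: "rcut r \<in> lev (Suc 0)"
  unfolding rcut_def by (rule mk_lev) auto

lemma rcut_eq_iff: "rcut r = rcut r' \<longleftrightarrow> r = r'"
proof
  assume "rcut r = rcut r'"
  then have "{num (to_nat q) | q::rat. of_rat q < r} = {num (to_nat q) | q::rat. of_rat q < r'}"
    unfolding rcut_def by (subst (asm) mk_eq_iff) (auto intro!: vboundedI[of _ 0])
  then have "num (to_nat q) \<in> {num (to_nat q) | q::rat. of_rat q < r} \<longleftrightarrow>
      num (to_nat q) \<in> {num (to_nat q) | q::rat. of_rat q < r'}" for q :: rat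
    by (rule arg_cong)
  then have *: "of_rat q < r \<longleftrightarrow> of_rat q < r'" for q :: rat
    by (simp add: inj_eq[OF inj_num])
  then show "r = r'"
    using of_rat_dense[of r r'] of_rat_dense[of r' r] by (metis linorder_less_linear not_less_iff_gr_or_eq)
qed simp

end


section \<open>Functions of countably many coordinates\<close>

definition cs :: "'k set \<Rightarrow> ('k idx \<Rightarrow> 'a) \<Rightarrow> bool" where
  "cs K f \<longleftrightarrow> (\<exists>J\<subseteq>K. countable J \<and> dep J f)"

text \<open>Countably many countable supports have a countable union. As \<Phi> is an arbitrary
  function of the whole sequence, pointwise choices that depend on countably many given functions
  stay in the model.\<close>

lemma cs_seq:
  assumes "\<And>i::nat. cs K (f i)"
  shows "cs K (\<lambda>w. \<Phi> (\<lambda>i. f i w))"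
proof -
  have "\<forall>i. \<exists>J. J \<subseteq> K \<and> countable J \<and> dep J (f i)" using assms unfolding cs_def by blast
  from choice[OF this] obtain J where "\<forall>i. J i \<subseteq> K \<and> countable (J i) \<and> dep (J i) (f i)" ..
  then have J: "\<And>i. J i \<subseteq> K" "\<And>i. countable (J i)" "\<And>i. dep (J i) (f i)" by simp_all
  have d: "dep (\<Union>i. J i) (f i)" for i by (rule dep_mono[OF J(3)]) blast
  have "dep (\<Union>i. J i) (\<lambda>w. \<Phi> (\<lambda>i. f i w))"
    unfolding dep_def
  proof (intro allI impI)
    fix v w :: "'a idx" assume "agree (\<Union>i. J i) v w"
    then have "(\<lambda>i. f i v) = (\<lambda>i. f i w)" using d unfolding dep_def by blast
    then show "\<Phi> (\<lambda>i. f i v) = \<Phi> (\<lambda>i. f i w)" by simp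
  qed
  then show ?thesis unfolding cs_def using J by (intro exI[of _ "\<Union>i. J i"]) auto
qed

lemma cs_map: "cs K f \<Longrightarrow> cs K (\<lambda>w. \<Phi> (f w))"
  using cs_seq[of K "\<lambda>_. f" "\<lambda>s. \<Phi> (s 0)"] by simp

lemma cs_Pair:
  assumes "cs K f" "cs K g"
  shows "cs K (\<lambda>w. (f w, g w))"
proof -
  obtain I J where "I \<subseteq> K" "countable I" "dep I f" "J \<subseteq> K" "countable J" "dep J g"
    using assms unfolding cs_def by blast
  moreover from this have "dep (I \<union> J) f" "dep (I \<union> J) g" by (auto elim: dep_mono)
  ultimately show ?thesis
    unfolding cs_def by (intro exI[of _ "I \<union> J"]) (auto simp: dep_def)
qed

lemma cs_map2: "cs K f \<Longrightarrow> cs K g \<Longrightarrow> cs K (\<lambda>w. \<Phi> (f w) (g w))"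
  using cs_map[OF cs_Pair, of K f g "\<lambda>(x, y). \<Phi> x y"] by simp

lemma cs_const: "cs K (\<lambda>w. c)"
  unfolding cs_def dep_def by (intro exI[of _ "{}"]) auto

lemma cs_fst: "cs K fst"
  unfolding cs_def dep_def agree_def by (intro exI[of _ "{}"]) auto

lemma cs_coord: "j \<in> K \<Longrightarrow> cs K (\<lambda>w. snd w j)"
  unfolding cs_def dep_def agree_def by (intro exI[of _ "{j}"]) auto

text \<open>The values may run through all levels: these functions represent the elementary
  extension before it is truncated.\<close>

definition vfuns :: "(nat \<Rightarrow> 'v) \<Rightarrow> ('v set \<Rightarrow> 'v) \<Rightarrow> 'k set \<Rightarrow> ('k idx \<Rightarrow> 'v) set" where
  "vfuns num mk K = {f. cs K f \<and> (\<forall>w. f w \<in> std_univ num mk)}"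


section \<open>The limit ultrapower\<close>

text \<open>The quotient is given by any map \<open>q\<close> that identifies exactly the functions
  equal almost everywhere. Leaving its target type open allows the model to be placed inside the
  field of \<lambda>.\<close>

locale ultra_universe = superstructure num mk
  for num :: "nat \<Rightarrow> 'v" and mk :: "'v set \<Rightarrow> 'v" +
  fixes K :: "'k set" and W :: "'k idx filter" and q :: "('k idx \<Rightarrow> 'v) \<Rightarrow> 'm"
  assumes ultraW: "ultra W"
    and fst_infinite: "eventually (\<lambda>w. n \<le> fst w) W"
    and q_eq: "f \<in> vfuns num mk K \<Longrightarrow> g \<in> vfuns num mk K \<Longrightarrow>
      q f = q g \<longleftrightarrow> eventually (\<lambda>w. f w = g w) W"
begin

abbreviation fn :: "('k idx \<Rightarrow> 'v) set" where "fn \<equiv> vfuns num mk K"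
abbreviation ev :: "('k idx \<Rightarrow> bool) \<Rightarrow> bool" where "ev P \<equiv> eventually P W"

definition Mod :: "'m set" where "Mod = q ` fn"

definition Emem :: "'m \<Rightarrow> 'm \<Rightarrow> bool" where
  "Emem a b \<longleftrightarrow> (\<exists>f\<in>fn. \<exists>g\<in>fn. a = q f \<and> b = q g \<and> ev (\<lambda>w. mem (f w) (g w)))"

definition star :: "'v \<Rightarrow> 'm" where "star v = q (\<lambda>_. v)"

lemma fnI: "cs K f \<Longrightarrow> (\<And>w. f w \<in> V) \<Longrightarrow> f \<in> fn"
  unfolding vfuns_def by blast

lemma fn_cs: "f \<in> fn \<Longrightarrow> cs K f" and fn_V: "f \<in> fn \<Longrightarrow> f w \<in> V"
  unfolding vfuns_def by blast+

lemma fn_const: "v \<in> V \<Longrightarrow> (\<lambda>_. v) \<in> fn"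
  by (intro fnI cs_const)

lemma fn_num: "cs K h \<Longrightarrow> (\<lambda>w. num (h w)) \<in> fn"
  by (rule fnI[OF cs_map[where \<Phi> = num] num_V])

lemma Emem_q:
  assumes "f \<in> fn" "g \<in> fn"
  shows "Emem (q f) (q g) \<longleftrightarrow> ev (\<lambda>w. mem (f w) (g w))"
proof
  assume "Emem (q f) (q g)"
  then obtain f' g' where f': "f' \<in> fn" "q f = q f'" and g': "g' \<in> fn" "q g = q g'"
    and *: "ev (\<lambda>w. mem (f' w) (g' w))"
    unfolding Emem_def by blast
  have "ev (\<lambda>w. f w = f' w)" "ev (\<lambda>w. g w = g' w)" using f' g' assms q_eq by auto
  with * show "ev (\<lambda>w. mem (f w) (g w))" by eventually_elim simp
qed (use assms in \<open>auto simp: Emem_def\<close>)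

text \<open>In the quantifier step a counterexample is chosen as a function of the values of the
  environment, so it has countable support again, by \<open>cs_seq\<close>.\<close>

lemma los:
  assumes "\<And>i. e i \<in> fn"
  shows "sat Mod Emem (\<lambda>i. q (e i)) p \<longleftrightarrow> ev (\<lambda>w. sat V mem (\<lambda>i. e i w) p)"
  using assms
proof (induction p arbitrary: e)
  case (All i p)
  let ?B = "\<lambda>s a. sat V mem (s(i := a)) p"
  have upd: "(\<lambda>j. q (e j))(i := q f) = (\<lambda>j. q ((e(i := f)) j))" for f by auto
  have updw: "(\<lambda>j. e j w)(i := f w) = (\<lambda>j. (e(i := f)) j w)" for f w by auto
  have L: "sat Mod Emem (\<lambda>i. q (e i)) (All i p) \<longleftrightarrow> (\<forall>f\<in>fn. ev (\<lambda>w. ?B (\<lambda>j. e j w) (f w)))"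
    using All.IH[of "e(i := f)" for f] All.prems
    by (simp add: Mod_def upd updw del: fun_upd_apply) (simp add: fun_upd_apply)
  show ?case
    unfolding L
  proof
    assume *: "\<forall>f\<in>fn. ev (\<lambda>w. ?B (\<lambda>j. e j w) (f w))"
    define \<Phi> where "\<Phi> = (\<lambda>s. if \<exists>a\<in>V. \<not> ?B s a then SOME a. a \<in> V \<and> \<not> ?B s a else num 0)"
    have \<Phi>: "\<Phi> s \<in> V" "a \<in> V \<Longrightarrow> ?B s (\<Phi> s) \<Longrightarrow> ?B s a" for s a
      using someI_ex[of "\<lambda>a. a \<in> V \<and> \<not> ?B s a"] num_V by (auto simp: \<Phi>_def split: if_splits)
    have "(\<lambda>w. \<Phi> (\<lambda>j. e j w)) \<in> fn"
      by (rule fnI[OF cs_seq[of K e \<Phi>] \<Phi>(1)]) (rule fn_cs[OF All.prems])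
    from bspec[OF * this] have "ev (\<lambda>w. ?B (\<lambda>j. e j w) (\<Phi> (\<lambda>j. e j w)))" .
    then show "ev (\<lambda>w. sat V mem (\<lambda>i. e i w) (All i p))"
      by eventually_elim (use \<Phi>(2) in auto)
  next
    assume *: "ev (\<lambda>w. sat V mem (\<lambda>i. e i w) (All i p))"
    show "\<forall>f\<in>fn. ev (\<lambda>w. ?B (\<lambda>j. e j w) (f w))"
    proof
      fix f assume "f \<in> fn"
      then have "f w \<in> V" for w by (rule fn_V)
      with * show "ev (\<lambda>w. ?B (\<lambda>j. e j w) (f w))" by (auto elim: eventually_mono)
    qed
  qed
qed (auto simp: Emem_q q_eq ultra_not[OF ultraW] eventually_conj_iff)

lemma star_Emem:
  assumes "f \<in> fn" "vbounded num mk A"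
  shows "Emem (q f) (star (mk A)) \<longleftrightarrow> ev (\<lambda>w. f w \<in> A)"
  using assms by (simp add: star_def Emem_q fn_const mk_V mem_mk)

lemma truncation_iff:
  assumes "f \<in> fn"
  shows "q f \<in> truncation num mk Mod Emem star \<longleftrightarrow> (\<exists>n. ev (\<lambda>w. f w \<in> lev n))"
  using assms by (auto simp: truncation_def Mod_def star_Emem vboundedI[OF order_refl])

text \<open>At the index \<open>w\<close>, a common member is taken of as many sets as possible
  among those numbered up to \<open>fst w\<close>. Since \<open>fst\<close> is infinite, each fixed
  set is almost everywhere among them. The witness belongs to the set numbered 0 almost everywhere,
  hence to a fixed level.\<close>

lemma saturated_Emem: "omega1_saturated (truncation num mk Mod Emem star) Emem"
  unfolding omega1_saturated_def
proof (intro allI impI, elim conjE)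
  let ?U = "truncation num mk Mod Emem star"
  fix F assume FU: "F \<subseteq> ?U" and cF: "countable F"
    and fip: "\<forall>G. finite G \<and> G \<subseteq> F \<longrightarrow> (\<exists>x\<in>?U. \<forall>a\<in>G. Emem x a)"
  show "\<exists>x\<in>?U. \<forall>a\<in>F. Emem x a"
  proof (cases "F = {}")
    case True
    then show ?thesis using fip by blast
  next
    case False
    define a where "a = from_nat_into F"
    have ra: "range a = F" using False cF by (simp add: a_def range_from_nat_into)
    have "\<forall>i. \<exists>g. g \<in> fn \<and> a i = q g" using FU ra by (auto simp: truncation_def Mod_def)
    from choice[OF this] obtain g where "\<forall>i. g i \<in> fn \<and> a i = q (g i)" ..
    then have g: "\<And>i. g i \<in> fn" "\<And>i. a i = q (g i)" by simp_all
    define B where "B = (\<lambda>s n. \<exists>v. \<forall>i\<le>n::nat. mem v (s i))"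
    have evB: "ev (\<lambda>w. B (\<lambda>i. g i w) n)" for n
    proof -
      have "finite (a ` {..n})" "a ` {..n} \<subseteq> F" using ra by auto
      then obtain x where x: "x \<in> ?U" "\<forall>i\<le>n. Emem x (a i)" using fip[rule_format, of "a ` {..n}"] by auto
      then obtain f where f: "f \<in> fn" "x = q f" by (auto simp: truncation_def Mod_def)
      have "\<forall>i\<in>{..n}. ev (\<lambda>w. mem (f w) (g i w))" using x(2) f g by (simp add: Emem_q)
      then have "ev (\<lambda>w. \<forall>i\<in>{..n}. mem (f w) (g i w))" by (simp add: eventually_ball_finite)
      then show ?thesis by eventually_elim (auto simp: B_def)
    qed
    define N where "N = (\<lambda>m s. GREATEST n. n \<le> m \<and> B s n)"
    define \<Phi> where "\<Phi> = (\<lambda>m s. if B s 0 then SOME v. \<forall>i\<le>N m s. mem v (s i) else num 0)"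
    have \<Phi>_mem: "mem (\<Phi> m s) (s i)" if "B s i" "i \<le> m" for m s i
    proof -
      have B0: "B s 0" using that(1) by (auto simp: B_def)
      have "N m s \<le> m \<and> B s (N m s)"
        unfolding N_def by (rule GreatestI_nat[of _ i m]) (use that in auto)
      moreover have "i \<le> N m s"
        unfolding N_def by (rule Greatest_le_nat[of _ i m]) (use that in auto)
      moreover from calculation have "\<forall>i\<le>N m s. mem (\<Phi> m s) (s i)"
        using B0 someI_ex[of "\<lambda>v. \<forall>i\<le>N m s. mem v (s i)"] by (auto simp: \<Phi>_def B_def)
      ultimately show ?thesis by blast
    qed
    have \<Phi>_V: "\<Phi> m s \<in> V" for m s
    proof (cases "B s 0")
      case True
      then show ?thesis using \<Phi>_mem[of s 0 m] mem_V by blast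
    qed (simp add: \<Phi>_def num_V)
    define f where "f = (\<lambda>w. \<Phi> (fst w) (\<lambda>i. g i w))"
    have f: "f \<in> fn"
      unfolding f_def
      by (rule fnI[OF cs_map2[where \<Phi> = \<Phi>, OF cs_fst cs_seq[of K g "\<lambda>s. s"]] \<Phi>_V]) (rule fn_cs[OF g(1)])
    have mem: "ev (\<lambda>w. mem (f w) (g i w))" for i
      using evB[of i] fst_infinite[of i] unfolding f_def
      by eventually_elim (rule \<Phi>_mem)
    have "q (g 0) \<in> ?U" using FU ra g(2) by auto
    then obtain n where "ev (\<lambda>w. g 0 w \<in> lev n)" using truncation_iff[OF g(1)] by blast
    with mem[of 0] have "ev (\<lambda>w. f w \<in> lev n)" by eventually_elim (rule mem_lev)
    then have "q f \<in> ?U" using truncation_iff[OF f] by blast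
    moreover have "Emem (q f) (a i)" for i using mem[of i] f g by (simp add: Emem_q)
    ultimately show ?thesis using ra by blast
  qed
qed

sublocale nonstandard_universe num mk Mod Emem star
proof
  show "elementary_embedding V mem Mod Emem star"
    unfolding elementary_embedding_def
  proof (intro conjI allI impI)
    show "star ` V \<subseteq> Mod" by (auto simp: star_def Mod_def fn_const)
    fix p and e :: "nat \<Rightarrow> 'v" assume "range e \<subseteq> V"
    then have "(\<lambda>_. e i) \<in> fn" for i by (intro fn_const) auto
    from los[of "\<lambda>i _. e i", OF this]
    show "sat V mem e p \<longleftrightarrow> sat Mod Emem (star \<circ> e) p"
      by (simp add: star_def o_def ultra_eventually_const[OF ultraW])
  qed
  show "\<exists>H\<in>Mod. Emem H (star (mk (range num))) \<and> H \<notin> star ` range num"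
  proof (intro bexI conjI)
    let ?f = "\<lambda>w. num (fst w)"
    have f: "?f \<in> fn" by (rule fn_num[OF cs_fst])
    then show "q ?f \<in> Mod" by (simp add: Mod_def)
    show "Emem (q ?f) (star (mk (range num)))"
      using star_Emem[OF f vbounded_nums] by simp
    show "q ?f \<notin> star ` range num"
    proof
      assume "q ?f \<in> star ` range num"
      then obtain n where "ev (\<lambda>w. fst w = n)"
        using q_eq[OF f fn_const[OF num_V]] by (auto simp: star_def inj_eq[OF inj_num])
      with fst_infinite[of "Suc n"] have "ev (\<lambda>w. False)" by eventually_elim simp
      then show False by (simp add: ultra_eventually_const[OF ultraW])
    qed
  qed
qed (rule saturated_Emem)

end


section \<open>Internal sets\<close>

context ultra_universe
begin

lemma W_not_bot: "W \<noteq> bot"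
  using ultraW by (simp add: ultra_def)

lemma U_iff: "f \<in> fn \<Longrightarrow> q f \<in> U \<longleftrightarrow> (\<exists>n. ev (\<lambda>w. f w \<in> lev n))"
  by (simp add: U_def truncation_iff)

lemma U_rep:
  assumes "x \<in> U"
  obtains f n where "f \<in> fn" "x = q f" "ev (\<lambda>w. f w \<in> lev n)"
proof -
  from assms have "x \<in> Mod" by (simp add: U_def truncation_def)
  then obtain f where "f \<in> fn" "x = q f" by (auto simp: Mod_def)
  with assms that show thesis using U_iff by blast
qed

lemma U_I:
  assumes "f \<in> fn" "\<And>w. f w \<in> lev n"
  shows "q f \<in> U"
  unfolding U_iff[OF assms(1)] by (intro exI[of _ n] always_eventually allI assms(2))

lemma ext_star_iff:
  assumes "f \<in> fn" "A \<subseteq> lev n"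
  shows "q f \<in> ext (star (mk A)) \<longleftrightarrow> ev (\<lambda>w. f w \<in> A)"
proof -
  have "ev (\<lambda>w. f w \<in> A) \<Longrightarrow> q f \<in> U"
    using assms U_iff by (metis (mono_tags, lifting) eventually_mono subsetD)
  then show ?thesis using star_Emem[OF assms(1) vboundedI[OF assms(2)]] by (auto simp: ext_def)
qed

lemma q_num_U: "cs K h \<Longrightarrow> q (\<lambda>w. num (h w)) \<in> U"
  by (rule U_I[of _ 0]) (auto intro: fn_num num_lev)

lemma q_num_eq: "cs K g \<Longrightarrow> cs K h \<Longrightarrow>
    q (\<lambda>w. num (g w)) = q (\<lambda>w. num (h w)) \<longleftrightarrow> ev (\<lambda>w. g w = h w)"
  using q_eq[OF fn_num fn_num] by (simp add: inj_eq[OF inj_num])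

lemma hypernat_q: "f \<in> fn \<Longrightarrow> q f \<in> hypernat \<longleftrightarrow> ev (\<lambda>w. f w \<in> range num)"
  unfolding hypernat_def natset_def by (rule ext_star_iff[of _ _ 0]) auto

lemma hypernat_iff: "x \<in> hypernat \<longleftrightarrow> (\<exists>h. cs K h \<and> x = q (\<lambda>w. num (h w)))"
proof
  assume x: "x \<in> hypernat"
  then obtain f n where f: "f \<in> fn" "x = q f" unfolding hypernat_def ext_def by (blast elim: U_rep)
  let ?h = "\<lambda>w. inv num (f w)"
  have h: "cs K ?h" by (rule cs_map[OF fn_cs[OF f(1)]])
  have "ev (\<lambda>w. f w \<in> range num)" using hypernat_q f x by blast
  then have "ev (\<lambda>w. f w = num (?h w))" by eventually_elim (simp add: f_inv_into_f)
  then have "x = q (\<lambda>w. num (?h w))" using f q_eq[OF f(1) fn_num[OF h]] by simp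
  with h show "\<exists>h. cs K h \<and> x = q (\<lambda>w. num (h w))" by blast
next
  assume "\<exists>h. cs K h \<and> x = q (\<lambda>w. num (h w))"
  then show "x \<in> hypernat" using hypernat_q[OF fn_num] by auto
qed

lemma infinite_hypernat_iff:
  "H \<in> infinite_hypernat \<longleftrightarrow>
    (\<exists>h. cs K h \<and> (\<forall>n. ev (\<lambda>w. n \<le> h w)) \<and> H = q (\<lambda>w. num (h w)))"
proof -
  have "q (\<lambda>w. num (h w)) \<notin> star ` range num \<longleftrightarrow> (\<forall>n. ev (\<lambda>w. n \<le> h w))" if h: "cs K h" for h
  proof -
    have "q (\<lambda>w. num (h w)) \<in> star ` range num \<longleftrightarrow> (\<exists>n. ev (\<lambda>w. h w = n))"
      unfolding star_def image_image using q_num_eq[OF h cs_const] by auto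
    also have "\<dots> \<longleftrightarrow> \<not> (\<forall>n. ev (\<lambda>w. n \<le> h w))"
    proof
      assume "\<exists>n. ev (\<lambda>w. h w = n)"
      then obtain n where "ev (\<lambda>w. h w = n)" by blast
      then have "ev (\<lambda>w. \<not> Suc n \<le> h w)" by eventually_elim simp
      then show "\<not> (\<forall>n. ev (\<lambda>w. n \<le> h w))" using ultra_not[OF ultraW] by blast
    next
      assume "\<not> (\<forall>n. ev (\<lambda>w. n \<le> h w))"
      then show "\<exists>n. ev (\<lambda>w. h w = n)" using ultra_infinite[OF ultraW] by blast
    qed
    finally show ?thesis by blast
  qed
  then show ?thesis unfolding infinite_hypernat_def by (auto simp: hypernat_iff)
qed

lemma internal_iff:
  assumes "f \<in> fn"
  shows "q f \<in> internal_sets \<longleftrightarrow> (\<exists>n. ev (\<lambda>w. f w \<in> lev n)) \<and> ev (\<lambda>w. f w \<notin> range num)"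
  unfolding internal_sets_def using U_iff[OF assms] hypernat_q[OF assms]
  by (simp add: ultra_not[OF ultraW])

text \<open>If the representatives differ almost everywhere, choosing pointwise an element of
  exactly one of them yields a point of the truncation that separates the two extents. Atoms have to
  be excluded, as all their extents are empty.\<close>

lemma ext_eq:
  assumes "a \<in> internal_sets" "b \<in> internal_sets" "ext a = ext b"
  shows "a = b"
proof (rule ccontr)
  assume "a \<noteq> b"
  obtain f m where f: "f \<in> fn" "a = q f" "ev (\<lambda>w. f w \<in> lev m)"
    using assms(1) U_rep unfolding internal_sets_def by blast
  obtain g n where g: "g \<in> fn" "b = q g" "ev (\<lambda>w. g w \<in> lev n)"
    using assms(2) U_rep unfolding internal_sets_def by blast
  have "ev (\<lambda>w. f w \<noteq> g w)" using \<open>a \<noteq> b\<close> f g q_eq by (simp add: ultra_not[OF ultraW])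
  moreover have "ev (\<lambda>w. f w \<notin> range num)" "ev (\<lambda>w. g w \<notin> range num)"
    using assms(1,2) f g internal_iff by blast+
  ultimately have ne: "ev (\<lambda>w. \<exists>x. mem x (f w) \<noteq> mem x (g w))"
    by eventually_elim (use set_ext fn_V[OF f(1)] fn_V[OF g(1)] in blast)
  define \<Phi> where "\<Phi> = (\<lambda>y z. if \<exists>x. mem x y \<noteq> mem x z then SOME x. mem x y \<noteq> mem x z else num 0)"
  have \<Phi>: "mem (\<Phi> y z) y \<noteq> mem (\<Phi> y z) z" if "\<exists>x. mem x y \<noteq> mem x z" for y z
    using someI_ex[OF that] that by (simp add: \<Phi>_def)
  have \<Phi>_V: "\<Phi> y z \<in> V" for y z
  proof (cases "\<exists>x. mem x y \<noteq> mem x z")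
    case True
    from \<Phi>[OF this] show ?thesis using mem_V by blast
  qed (simp add: \<Phi>_def num_V)
  define c where "c = (\<lambda>w. \<Phi> (f w) (g w))"
  have c: "c \<in> fn"
    unfolding c_def by (rule fnI[OF cs_map2[OF fn_cs[OF f(1)] fn_cs[OF g(1)]] \<Phi>_V])
  have d: "ev (\<lambda>w. mem (c w) (f w) \<noteq> mem (c w) (g w))"
    using ne unfolding c_def by eventually_elim (rule \<Phi>)
  have "ev (\<lambda>w. c w \<in> lev (max m n))"
    using d f(3) g(3)
  proof eventually_elim
    case (elim w)
    then have "c w \<in> lev m \<or> c w \<in> lev n" using mem_lev by blast
    then show ?case using lev_mono[of m "max m n"] lev_mono[of n "max m n"] by auto
  qed
  then have "q c \<in> U" using U_iff[OF c] by blast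
  then have "ev (\<lambda>w. mem (c w) (f w)) \<longleftrightarrow> ev (\<lambda>w. mem (c w) (g w))"
    using assms(3) Emem_q[OF c f(1)] Emem_q[OF c g(1)] f(2) g(2) by (auto simp: ext_def)
  moreover have "ev (\<lambda>w. mem (c w) (g w)) \<longleftrightarrow> ev (\<lambda>w. \<not> mem (c w) (f w))"
    using d by (intro eventually_cong[OF d]) blast
  ultimately show False by (simp add: ultra_not[OF ultraW])
qed

lemma q_pair_set:
  assumes f: "f \<in> fn" "q f \<in> U" and g: "g \<in> fn" "q g \<in> U"
  shows "(\<lambda>w. mk {f w, g w}) \<in> fn" "q (\<lambda>w. mk {f w, g w}) \<in> internal_sets"
    "ext (q (\<lambda>w. mk {f w, g w})) = {q f, q g}"
proof -
  let ?p = "\<lambda>w. mk {f w, g w}"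
  have b: "vbounded num mk {f w, g w}" for w using f g fn_V vbounded_pair by blast
  show p: "?p \<in> fn"
    by (rule fnI[OF cs_map2[OF fn_cs[OF f(1)] fn_cs[OF g(1)], where \<Phi> = "\<lambda>x y. mk {x, y}"] mk_V[OF b]])
  obtain m where m: "ev (\<lambda>w. f w \<in> lev m)" using U_iff f by blast
  obtain n where n: "ev (\<lambda>w. g w \<in> lev n)" using U_iff g by blast
  have "ev (\<lambda>w. ?p w \<in> lev (Suc (max m n)))"
    using m n
  proof eventually_elim
    case (elim w)
    then show ?case using lev_mono[of m "max m n"] lev_mono[of n "max m n"] by (intro mk_lev) auto
  qed
  moreover have "?p w \<notin> range num" for w by (rule mk_not_num[OF b])
  ultimately show "q ?p \<in> internal_sets"
    unfolding internal_iff[OF p] by (intro conjI exI[of _ "Suc (max m n)"]) (auto intro: always_eventually)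
  show "ext (q ?p) = {q f, q g}"
  proof (rule set_eqI)
    fix x
    show "x \<in> ext (q ?p) \<longleftrightarrow> x \<in> {q f, q g}"
    proof (cases "x \<in> U")
      case True
      then obtain c n where c: "c \<in> fn" "x = q c" by (rule U_rep)
      have "x \<in> ext (q ?p) \<longleftrightarrow> ev (\<lambda>w. c w = f w \<or> c w = g w)"
        using True c Emem_q[OF c(1) p] by (simp add: ext_def mem_mk[OF b])
      also have "\<dots> \<longleftrightarrow> x \<in> {q f, q g}"
        using c f g q_eq by (simp add: ultra_disj[OF ultraW])
      finally show ?thesis .
    qed (use f g in \<open>auto simp: ext_def\<close>)
  qed
qed

text \<open>The description is resolved by extensionality, used for the two inner sets and then for
  the pair itself.\<close>

lemma star_pair_q:
  assumes f: "f \<in> fn" "q f \<in> U" and g: "g \<in> fn" "q g \<in> U"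
  shows "star_pair (q f) (q g) = q (\<lambda>w. vpair (f w) (g w))"
proof -
  let ?a = "\<lambda>w. mk {f w}" and ?b = "\<lambda>w. mk {f w, g w}"
  have a: "?a \<in> fn" "q ?a \<in> internal_sets" "ext (q ?a) = {q f}"
    using q_pair_set[OF f f] by simp_all
  note b = q_pair_set[OF f g]
  have "q ?a \<in> U" "q ?b \<in> U" using a b by (auto simp: internal_sets_def)
  note p = q_pair_set[OF a(1) this(1) b(1) this(2)]
  have "star_pair (q f) (q g) = q (\<lambda>w. mk {mk {f w}, mk {f w, g w}})"
    unfolding star_pair_def
  proof (rule the_equality)
    show "q (\<lambda>w. mk {mk {f w}, mk {f w, g w}}) \<in> internal_sets \<and>
      (\<exists>a\<in>internal_sets. \<exists>b\<in>internal_sets. ext a = {q f} \<and> ext b = {q f, q g} \<and>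
        ext (q (\<lambda>w. mk {mk {f w}, mk {f w, g w}})) = {a, b})"
      using a b p by blast
  next
    fix p' assume p': "p' \<in> internal_sets \<and> (\<exists>a\<in>internal_sets. \<exists>b\<in>internal_sets.
        ext a = {q f} \<and> ext b = {q f, q g} \<and> ext p' = {a, b})"
    then obtain a' b' where ab: "a' \<in> internal_sets" "b' \<in> internal_sets" "ext a' = {q f}"
      "ext b' = {q f, q g}" "ext p' = {a', b'}" by blast
    have "a' = q ?a" by (rule ext_eq[OF ab(1) a(2)]) (simp add: ab(3) a(3))
    moreover have "b' = q ?b" by (rule ext_eq[OF ab(2) b(2)]) (simp add: ab(4) b(3))
    ultimately have "ext p' = ext (q (\<lambda>w. mk {mk {f w}, mk {f w, g w}}))" using ab(5) p(3) by simp
    with p' p(2) show "p' = q (\<lambda>w. mk {mk {f w}, mk {f w, g w}})" by (blast intro: ext_eq)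
  qed
  then show ?thesis by (simp add: vpair_def)
qed

lemma fn_vpair: "f \<in> fn \<Longrightarrow> g \<in> fn \<Longrightarrow> (\<lambda>w. vpair (f w) (g w)) \<in> fn"
  by (rule fnI[OF cs_map2[OF fn_cs fn_cs, where \<Phi> = vpair] vpair_V[OF fn_V fn_V]])

lemma hyper_le_q:
  assumes "cs K g" "cs K h"
  shows "hyper_le (q (\<lambda>w. num (g w))) (q (\<lambda>w. num (h w))) \<longleftrightarrow> ev (\<lambda>w. g w \<le> h w)"
proof -
  let ?A = "{vpair (num m) (num n) | m n. m \<le> n}"
  have A: "?A \<subseteq> lev (Suc (Suc 0))" using vpair_lev[OF num_lev num_lev] by blast
  have "vpair (num m) (num n) \<in> ?A \<longleftrightarrow> m \<le> n" for m n
    by (auto simp: vpair_eq_iff num_V inj_eq[OF inj_num])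
  then show ?thesis
    unfolding hyper_le_def le_code_def
    using star_pair_q[OF fn_num[OF assms(1)] q_num_U[OF assms(1)] fn_num[OF assms(2)] q_num_U[OF assms(2)]]
      ext_star_iff[OF fn_vpair[OF fn_num[OF assms(1)] fn_num[OF assms(2)]] A]
    by simp
qed

text \<open>The relation \<open>A\<close> is single-valued already in \<open>V\<close>, so any
  competing value agrees with \<open>v\<close> at almost every index.\<close>

lemma star_app_q:
  assumes u: "u \<in> fn" "q u \<in> U" and v: "v \<in> fn" "q v \<in> U"
    and A: "A \<subseteq> lev n" and ev: "ev (\<lambda>w. vpair (u w) (v w) \<in> A)"
    and sv: "\<And>x y y'. x \<in> V \<Longrightarrow> y \<in> V \<Longrightarrow> y' \<in> V \<Longrightarrow> vpair x y \<in> A \<Longrightarrow> vpair x y' \<in> A \<Longrightarrow> y = y'"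
  shows "star_app (star (mk A)) (q u) = q v"
  unfolding star_app_def
proof (rule the_equality)
  show "q v \<in> U \<and> star_pair (q u) (q v) \<in> ext (star (mk A))"
    using v ev by (simp add: star_pair_q[OF u v] ext_star_iff[OF fn_vpair[OF u(1) v(1)] A])
next
  fix y assume y: "y \<in> U \<and> star_pair (q u) y \<in> ext (star (mk A))"
  then obtain v' n where v': "v' \<in> fn" "y = q v'" using U_rep by blast
  have "ev (\<lambda>w. vpair (u w) (v' w) \<in> A)"
    using y v' star_pair_q[OF u v'(1)] ext_star_iff[OF fn_vpair[OF u(1) v'(1)] A] by simp
  with ev have "ev (\<lambda>w. v' w = v w)"
    by eventually_elim (use sv fn_V u(1) v(1) v'(1) in blast)
  then show "y = q v" using q_eq v(1) v' by simp
qed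

section \<open>Hyperfinite intervals and their internal subsets\<close>

lemma Omega_iff:
  assumes h: "cs K h"
  shows "x \<in> Omega (q (\<lambda>w. num (h w))) \<longleftrightarrow>
    (\<exists>g. cs K g \<and> x = q (\<lambda>w. num (g w)) \<and> ev (\<lambda>w. g w \<in> {1..h w}))"
proof -
  have "hyper_le (star (num 1)) (q (\<lambda>w. num (g w))) \<and> hyper_le (q (\<lambda>w. num (g w))) (q (\<lambda>w. num (h w)))
      \<longleftrightarrow> ev (\<lambda>w. g w \<in> {1..h w})" if g: "cs K g" for g
    using hyper_le_q[OF g h] hyper_le_q[OF cs_const g, of 1]
    by (simp add: star_def eventually_conj_iff)
  then show ?thesis unfolding Omega_def hypernat_iff by blast
qed

text \<open>The ultraproduct of the sets \<open>A w\<close>, as an element of the model.\<close>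

definition iset :: "('k idx \<Rightarrow> nat set) \<Rightarrow> 'm" where
  "iset A = q (\<lambda>w. mk (num ` A w))"

lemma fn_iset: "cs K A \<Longrightarrow> (\<lambda>w. mk (num ` A w)) \<in> fn"
  by (rule fnI[OF cs_map[where \<Phi> = "\<lambda>X. mk (num ` X)"] mk_V[OF vbounded_nums]])

lemma mk_nums_lev: "mk (num ` A) \<in> lev (Suc 0)"
  by (rule mk_lev) auto

lemma iset_U: "cs K A \<Longrightarrow> iset A \<in> U"
  unfolding iset_def by (rule U_I[OF fn_iset mk_nums_lev])

lemma iset_internal: "cs K A \<Longrightarrow> iset A \<in> internal_sets"
  unfolding iset_def internal_iff[OF fn_iset]
  using mk_nums_lev mk_not_num[OF vbounded_nums] by (auto intro!: exI[of _ "Suc 0"])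

lemma iset_eq: "cs K A \<Longrightarrow> cs K B \<Longrightarrow> iset A = iset B \<longleftrightarrow> ev (\<lambda>w. A w = B w)"
  unfolding iset_def
  by (simp add: q_eq[OF fn_iset fn_iset] mk_eq_iff[OF vbounded_nums vbounded_nums] inj_image_eq_iff[OF inj_num])

lemma mem_ext_iset:
  assumes "cs K A" "cs K g"
  shows "q (\<lambda>w. num (g w)) \<in> ext (iset A) \<longleftrightarrow> ev (\<lambda>w. g w \<in> A w)"
  using Emem_q[OF fn_num[OF assms(2)] fn_iset[OF assms(1)]] q_num_U[OF assms(2)]
  by (simp add: ext_def iset_def mem_mk[OF vbounded_nums] inj_image_mem_iff[OF inj_num])

lemma ext_iset_hypernat:
  assumes A: "cs K A" and x: "x \<in> ext (iset A)"
  shows "x \<in> hypernat"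
proof -
  obtain f n where f: "f \<in> fn" "x = q f" using x U_rep by (auto simp: ext_def)
  have "ev (\<lambda>w. f w \<in> num ` A w)"
    using x Emem_q[OF f(1) fn_iset[OF A]] by (simp add: f(2) ext_def iset_def mem_mk[OF vbounded_nums])
  then have "ev (\<lambda>w. f w \<in> range num)" by eventually_elim blast
  then show ?thesis using f hypernat_q by blast
qed

lemma ext_iset:
  assumes "cs K A"
  shows "ext (iset A) = {q (\<lambda>w. num (g w)) | g. cs K g \<and> ev (\<lambda>w. g w \<in> A w)}"
proof
  show "ext (iset A) \<subseteq> {q (\<lambda>w. num (g w)) | g. cs K g \<and> ev (\<lambda>w. g w \<in> A w)}"
  proof
    fix x assume x: "x \<in> ext (iset A)"
    then obtain g where "cs K g" "x = q (\<lambda>w. num (g w))"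
      using ext_iset_hypernat[OF assms] hypernat_iff by blast
    then show "x \<in> {q (\<lambda>w. num (g w)) | g. cs K g \<and> ev (\<lambda>w. g w \<in> A w)}"
      using x mem_ext_iset[OF assms] by blast
  qed
  show "{q (\<lambda>w. num (g w)) | g. cs K g \<and> ev (\<lambda>w. g w \<in> A w)} \<subseteq> ext (iset A)"
    using mem_ext_iset[OF assms] by blast
qed

text \<open>Cutting a representative down to \<open>{1..h w}\<close> at every \<open>w\<close> makes
  all its values finite without exception. The cut changes nothing modulo \<open>W\<close>:
  otherwise a pointwise choice of members outside the interval would be a point of
  \<open>ext a\<close> outside \<open>Omega\<close>.\<close>

lemma internal_subsets_iff:
  assumes h: "cs K h"
  shows "a \<in> internal_subsets (q (\<lambda>w. num (h w))) \<longleftrightarrow>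
    (\<exists>A. cs K A \<and> (\<forall>w. A w \<subseteq> {1..h w}) \<and> a = iset A)"
proof
  assume "\<exists>A. cs K A \<and> (\<forall>w. A w \<subseteq> {1..h w}) \<and> a = iset A"
  then obtain A where A: "cs K A" "\<And>w. A w \<subseteq> {1..h w}" "a = iset A" by blast
  have "ext a \<subseteq> Omega (q (\<lambda>w. num (h w)))"
  proof
    fix x assume "x \<in> ext a"
    then obtain g where g: "cs K g" "x = q (\<lambda>w. num (g w))" "ev (\<lambda>w. g w \<in> A w)"
      using A by (auto simp: ext_iset)
    have "ev (\<lambda>w. g w \<in> {1..h w})" using g(3) by eventually_elim (use A(2) in blast)
    then show "x \<in> Omega (q (\<lambda>w. num (h w)))" using Omega_iff[OF h] g by blast
  qed
  then show "a \<in> internal_subsets (q (\<lambda>w. num (h w)))"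
    using A iset_internal by (simp add: internal_subsets_def)
next
  assume a: "a \<in> internal_subsets (q (\<lambda>w. num (h w)))"
  then have ai: "a \<in> internal_sets" and ao: "ext a \<subseteq> Omega (q (\<lambda>w. num (h w)))"
    by (auto simp: internal_subsets_def)
  obtain f n where f: "f \<in> fn" "a = q f" "ev (\<lambda>w. f w \<in> lev n)"
    using ai U_rep unfolding internal_sets_def by blast
  have set: "ev (\<lambda>w. f w \<notin> range num)" using ai f internal_iff by blast
  define A where "A = (\<lambda>w. {m \<in> {1..h w}. mem (num m) (f w)})"
  have A: "cs K A" unfolding A_def
    by (rule cs_map2[OF h fn_cs[OF f(1)], where \<Phi> = "\<lambda>n y. {m \<in> {1..n}. mem (num m) y}"])
  define \<Phi> where "\<Phi> = (\<lambda>n y. if \<exists>x. mem x y \<and> x \<notin> num ` {1..n} then SOME x. mem x y \<and> x \<notin> num ` {1..n} else num 0)"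
  have \<Phi>: "mem (\<Phi> m y) y \<and> \<Phi> m y \<notin> num ` {1..m}" if "\<exists>x. mem x y \<and> x \<notin> num ` {1..m}" for m y
    using someI_ex[OF that] that by (simp add: \<Phi>_def)
  have \<Phi>_V: "\<Phi> m y \<in> V" for m y
  proof (cases "\<exists>x. mem x y \<and> x \<notin> num ` {1..m}")
    case True
    from \<Phi>[OF this] show ?thesis using mem_V by blast
  next
    case False
    then have "\<Phi> m y = num 0" unfolding \<Phi>_def by (rule if_not_P)
    then show ?thesis by (simp add: num_V)
  qed
  define c where "c = (\<lambda>w. \<Phi> (h w) (f w))"
  have c: "c \<in> fn" unfolding c_def by (rule fnI[OF cs_map2[OF h fn_cs[OF f(1)]] \<Phi>_V])
  have sub: "ev (\<lambda>w. \<not> (\<exists>x. mem x (f w) \<and> x \<notin> num ` {1..h w}))"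
  proof (rule ccontr)
    assume "\<not> ?thesis"
    then have "ev (\<lambda>w. \<exists>x. mem x (f w) \<and> x \<notin> num ` {1..h w})"
      by (simp add: ultra_not[OF ultraW] del: not_ex)
    then have d: "ev (\<lambda>w. mem (c w) (f w) \<and> c w \<notin> num ` {1..h w})"
      unfolding c_def by eventually_elim (rule \<Phi>)
    have "ev (\<lambda>w. c w \<in> lev n)" using d f(3) by eventually_elim (use mem_lev in blast)
    then have "q c \<in> ext a"
      using c f Emem_q d U_iff by (auto simp: ext_def eventually_conj_iff)
    then obtain g where g: "cs K g" "q c = q (\<lambda>w. num (g w))" "ev (\<lambda>w. g w \<in> {1..h w})"
      using ao Omega_iff[OF h] by blast
    have "ev (\<lambda>w. c w = num (g w))" using q_eq[OF c fn_num[OF g(1)]] g(2) by simp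
    with d g(3) have "ev (\<lambda>w. False)" by eventually_elim auto
    then show False by (simp add: ultra_eventually_const[OF ultraW])
  qed
  have "ev (\<lambda>w. f w = mk (num ` A w))"
    using sub set
  proof eventually_elim
    case (elim w)
    have "mem x (f w) \<longleftrightarrow> mem x (mk (num ` A w))" for x
      unfolding mem_mk[OF vbounded_nums] A_def using elim(1) by auto
    then show ?case
      using elim(2) by (intro set_ext fn_V[OF f(1)] mk_V vbounded_nums mk_not_num)
  qed
  then have "a = iset A" using q_eq[OF f(1) fn_iset[OF A]] f(2) by (simp add: iset_def)
  then show "\<exists>A. cs K A \<and> (\<forall>w. A w \<subseteq> {1..h w}) \<and> a = iset A"
    using A by (auto simp: A_def)
qed


section \<open>The Loeb measure\<close>

lemma hypercard_iset:
  assumes A: "cs K A" "\<And>w. finite (A w)"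
  shows "hypercard (iset A) = q (\<lambda>w. num (card (A w)))"
  unfolding hypercard_def card_code_def iset_def
proof (rule star_app_q[OF fn_iset[OF A(1)] _ fn_num q_num_U])
  have c: "cs K (\<lambda>w. card (A w))" by (rule cs_map[OF A(1)])
  then show "cs K (\<lambda>w. card (A w))" "cs K (\<lambda>w. card (A w))" by simp_all
  show "q (\<lambda>w. mk (num ` A w)) \<in> U" using iset_U[OF A(1)] by (simp add: iset_def)
  show "{vpair (mk (num ` A)) (num (card A)) |A. finite A} \<subseteq> lev (Suc (Suc (Suc 0)))"
    using vpair_lev[OF mk_nums_lev num_lev] by blast
  show "ev (\<lambda>w. vpair (mk (num ` A w)) (num (card (A w))) \<in> {vpair (mk (num ` A)) (num (card A)) |A. finite A})"
    using A(2) by (intro always_eventually) blast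
  fix x y y' assume V: "x \<in> V" "y \<in> V" "y' \<in> V"
    and 1: "vpair x y \<in> {vpair (mk (num ` A)) (num (card A)) |A. finite A}"
    and 2: "vpair x y' \<in> {vpair (mk (num ` A)) (num (card A)) |A. finite A}"
  obtain A B where "vpair x y = vpair (mk (num ` A)) (num (card A))"
    "vpair x y' = vpair (mk (num ` B)) (num (card B))"
    using 1 2 by blast
  then have "x = mk (num ` A)" "y = num (card A)" "x = mk (num ` B)" "y' = num (card B)"
    using V by (simp_all add: vpair_eq_iff num_V mk_V[OF vbounded_nums])
  then show "y = y'"
    by (auto simp: mk_eq_iff[OF vbounded_nums vbounded_nums] inj_image_eq_iff[OF inj_num])
qed

lemma P_iset:
  assumes A: "cs K A" "\<And>w. finite (A w)" and h: "cs K h" "ev (\<lambda>w. 0 < h w)"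
  shows "P (q (\<lambda>w. num (h w))) (iset A) = q (\<lambda>w. rcut (real (card (A w)) / real (h w)))"
proof -
  let ?c = "\<lambda>w. card (A w)"
  let ?D = "{vpair (vpair (num m) (num n)) (rcut (real m / real n)) | m n. n > 0}"
  have c: "cs K ?c" by (rule cs_map[OF A(1)])
  let ?p = "\<lambda>w. vpair (num (?c w)) (num (h w))" and ?v = "\<lambda>w. rcut (real (?c w) / real (h w))"
  have p: "?p \<in> fn" by (rule fn_vpair[OF fn_num[OF c] fn_num[OF h(1)]])
  have v: "?v \<in> fn"
    by (rule fnI[OF cs_map2[OF c h(1), where \<Phi> = "\<lambda>m n. rcut (real m / real n)"] lev_V[OF rcut_lev]])
  have "star_app (star (mk ?D)) (q ?p) = q ?v"
  proof (rule star_app_q[OF p _ v])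
    show "q ?p \<in> U" by (rule U_I[OF p, of "Suc (Suc 0)"]) (rule vpair_lev[OF num_lev num_lev])
    show "q ?v \<in> U" by (rule U_I[OF v rcut_lev])
    show "?D \<subseteq> lev (Suc (Suc (Suc (Suc 0))))"
    proof
      fix x assume "x \<in> ?D"
      then obtain m n where x: "x = vpair (vpair (num m) (num n)) (rcut (real m / real n))" by blast
      have "rcut r \<in> lev (Suc (Suc 0))" for r using rcut_lev lev_mono[of "Suc 0" "Suc (Suc 0)"] by auto
      then show "x \<in> lev (Suc (Suc (Suc (Suc 0))))"
        unfolding x by (rule vpair_lev[OF vpair_lev[OF num_lev num_lev]])
    qed
    show "ev (\<lambda>w. vpair (?p w) (?v w) \<in> ?D)" using h(2) by eventually_elim blast
    fix x y y' assume "x \<in> V" "y \<in> V" "y' \<in> V" "vpair x y \<in> ?D" "vpair x y' \<in> ?D"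
    then show "y = y'"
      by (auto simp: vpair_eq_iff num_V vpair_V lev_V[OF rcut_lev] inj_eq[OF inj_num])
  qed
  then show ?thesis
    unfolding P_def hypercard_iset[OF A] div_code_def
      star_pair_q[OF fn_num[OF c] q_num_U[OF c] fn_num[OF h(1)] q_num_U[OF h(1)]] .
qed

text \<open>Since \<open>rcut\<close> is injective, lying in the extension of an interval means that
  \<open>r\<close> takes values in that interval almost everywhere. The condition defining
  \<open>st\<close> therefore says that \<open>r\<close> converges along \<open>W\<close>.\<close>

lemma st_rcut:
  assumes r: "cs K r" and lim: "(r \<longlongrightarrow> l) W"
  shows "st (q (\<lambda>w. rcut (r w))) = l"
proof -
  have v: "(\<lambda>w. rcut (r w)) \<in> fn"
    by (rule fnI[OF cs_map[OF r, where \<Phi> = rcut] lev_V[OF rcut_lev]])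
  have "q (\<lambda>w. rcut (r w)) \<in> ext (star (mk (rcut ` X))) \<longleftrightarrow> ev (\<lambda>w. r w \<in> X)" for X
  proof -
    have "rcut ` X \<subseteq> lev (Suc 0)" using rcut_lev by blast
    from ext_star_iff[OF v this] show ?thesis by (simp add: image_iff rcut_eq_iff)
  qed
  then have "(\<forall>\<epsilon>>0. q (\<lambda>w. rcut (r w)) \<in> ext (star (mk (rcut ` {x. \<bar>x - l'\<bar> < \<epsilon>})))) \<longleftrightarrow> (r \<longlongrightarrow> l') W" for l'
    by (simp add: tendsto_iff dist_real_def)
  then show ?thesis
    unfolding st_def using lim tendsto_unique[OF W_not_bot] by (intro the_equality) blast+
qed

end


section \<open>Loeb measure as density along the ultrafilter\<close>

locale infinite_loeb = ultra_universe +
  fixes h :: "'b idx \<Rightarrow> nat"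
  assumes csh: "cs K h" and h_inf: "ev (\<lambda>w. n \<le> h w)"
begin

abbreviation H :: 'c where "H \<equiv> q (\<lambda>w. num (h w))"

definition adm :: "('b idx \<Rightarrow> nat set) \<Rightarrow> bool" where
  "adm A \<longleftrightarrow> cs K A \<and> (\<forall>w. A w \<subseteq> {1..h w})"

definition dens :: "('b idx \<Rightarrow> nat set) \<Rightarrow> real" where
  "dens A = Lim W (\<lambda>w. real (card (A w)) / real (h w))"

lemma adm_finite: "adm A \<Longrightarrow> finite (A w)"
  unfolding adm_def using finite_subset by blast

lemma adm_op:
  assumes "adm A" "adm B" "\<And>X Y. \<Phi> X Y \<subseteq> X \<union> Y"
  shows "adm (\<lambda>w. \<Phi> (A w) (B w))"
  using assms cs_map2[of K A B \<Phi>] unfolding adm_def by (metis Un_subset_iff subset_trans sup.absorb_iff2)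

lemma ratio_bounds:
  assumes "adm A"
  shows "real (card (A w)) / real (h w) \<in> {0..1}"
proof -
  have "A w \<subseteq> {1..h w}" using assms unfolding adm_def by blast
  then have "card (A w) \<le> card {1..h w}" by (intro card_mono) auto
  then show ?thesis by (auto simp: divide_le_eq_1)
qed

lemma dens_tendsto:
  assumes "adm A"
  shows "((\<lambda>w. real (card (A w)) / real (h w)) \<longlongrightarrow> dens A) W"
proof -
  obtain l where "((\<lambda>w. real (card (A w)) / real (h w)) \<longlongrightarrow> l) W"
    by (rule ultra_tendsto_compact[OF ultraW compact_Icc ratio_bounds[OF assms]])
  then show ?thesis unfolding dens_def by (simp only: tendsto_Lim[OF W_not_bot])
qed

lemma dens_nonneg: "adm A \<Longrightarrow> 0 \<le> dens A"
  using tendsto_lowerbound[OF dens_tendsto _ W_not_bot, of A 0] by (simp add: always_eventually)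

lemma st_P:
  assumes "adm A"
  shows "st (P H (iset A)) = dens A"
proof -
  have A: "cs K A" using assms by (simp add: adm_def)
  have h0: "ev (\<lambda>w. 0 < h w)" using h_inf[of 1] by eventually_elim simp
  show ?thesis
    unfolding P_iset[OF A adm_finite[OF assms] csh h0]
    by (intro st_rcut dens_tendsto[OF assms]
        cs_map2[OF A csh, where \<Phi> = "\<lambda>X n. real (card X) / real n"])
qed

lemma dens_cong:
  assumes "adm A" "adm B" "ev (\<lambda>w. A w = B w)"
  shows "dens A = dens B"
proof -
  have "ev (\<lambda>w. real (card (A w)) / real (h w) = real (card (B w)) / real (h w))"
    using assms(3) by eventually_elim simp
  then have "((\<lambda>w. real (card (B w)) / real (h w)) \<longlongrightarrow> dens A) W"
    by (rule Lim_transform_eventually[OF dens_tendsto[OF assms(1)]])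
  then show ?thesis using dens_tendsto[OF assms(2)] tendsto_unique[OF W_not_bot] by blast
qed

lemma internal_subsets_adm: "internal_subsets H = iset ` Collect adm"
  using internal_subsets_iff[OF csh] by (auto simp: adm_def)

definition alg :: "'c set set" where "alg = ext ` internal_subsets H"

lemma alg_iff: "X \<in> alg \<longleftrightarrow> (\<exists>A. adm A \<and> X = ext (iset A))"
  by (auto simp: alg_def internal_subsets_adm)

lemma ext_iset_eq:
  assumes "adm A" "adm B"
  shows "ext (iset A) = ext (iset B) \<longleftrightarrow> ev (\<lambda>w. A w = B w)"
proof -
  have cs: "cs K A" "cs K B" using assms by (auto simp: adm_def)
  have "ext (iset A) = ext (iset B) \<longleftrightarrow> iset A = iset B"
    using ext_eq[OF iset_internal[OF cs(1)] iset_internal[OF cs(2)]] by auto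
  then show ?thesis using iset_eq[OF cs] by simp
qed

text \<open>Both operations stay inside the union of their arguments, so it suffices to compare them
  at hypernaturals, and these have a representative \<open>g\<close>.\<close>

lemma ext_iset_op:
  assumes A: "adm A" "adm B" and sub: "\<And>X Y. \<Phi> X Y \<subseteq> X \<union> Y"
    and op: "\<And>g. cs K g \<Longrightarrow> ev (\<lambda>w. g w \<in> \<Phi> (A w) (B w)) \<longleftrightarrow>
      q (\<lambda>w. num (g w)) \<in> \<Phi>' (ext (iset A)) (ext (iset B))"
    and sub': "\<And>X Y. \<Phi>' X Y \<subseteq> X \<union> Y"
  shows "ext (iset (\<lambda>w. \<Phi> (A w) (B w))) = \<Phi>' (ext (iset A)) (ext (iset B))"
proof (rule set_eqI)
  fix x
  have cs: "cs K A" "cs K B" "cs K (\<lambda>w. \<Phi> (A w) (B w))"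
    using A adm_op[OF A sub] by (auto simp: adm_def)
  show "x \<in> ext (iset (\<lambda>w. \<Phi> (A w) (B w))) \<longleftrightarrow> x \<in> \<Phi>' (ext (iset A)) (ext (iset B))"
  proof (cases "x \<in> hypernat")
    case True
    then obtain g where "cs K g" "x = q (\<lambda>w. num (g w))" by (auto simp: hypernat_iff)
    then show ?thesis using op mem_ext_iset[OF cs(3)] by simp
  next
    case False
    then show ?thesis using ext_iset_hypernat cs sub' by blast
  qed
qed

lemma ext_iset_Un: "adm A \<Longrightarrow> adm B \<Longrightarrow> ext (iset (\<lambda>w. A w \<union> B w)) = ext (iset A) \<union> ext (iset B)"
  by (rule ext_iset_op) (auto simp: mem_ext_iset adm_def ultra_disj[OF ultraW])

lemma ext_iset_Diff: "adm A \<Longrightarrow> adm B \<Longrightarrow> ext (iset (\<lambda>w. A w - B w)) = ext (iset A) - ext (iset B)"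
  by (rule ext_iset_op) (auto simp: mem_ext_iset adm_def eventually_conj_iff ultra_not[OF ultraW])

lemma adm_empty: "adm (\<lambda>w. {})"
  by (simp add: adm_def cs_const)

lemma ext_iset_empty: "ext (iset (\<lambda>w. {})) = {}"
  by (simp add: ext_iset cs_const ultra_eventually_const[OF ultraW])

lemma alg_Pow: "alg \<subseteq> Pow (Omega H)"
  by (auto simp: alg_def internal_subsets_def)

lemma alg_ring: "ring_of_sets (Omega H) alg"
proof -
  have Un: "X \<union> Y \<in> alg" and Diff: "X - Y \<in> alg" if XY: "X \<in> alg" "Y \<in> alg" for X Y
  proof -
    obtain A B where A: "adm A" "X = ext (iset A)" and B: "adm B" "Y = ext (iset B)"
      using XY by (auto simp: alg_iff)
    show "X \<union> Y \<in> alg"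
      using ext_iset_Un[OF A(1) B(1)] adm_op[OF A(1) B(1), of "(\<union>)"] A B unfolding alg_iff by blast
    show "X - Y \<in> alg"
      using ext_iset_Diff[OF A(1) B(1)] adm_op[OF A(1) B(1), of "(-)"] A B unfolding alg_iff by blast
  qed
  moreover have "{} \<in> alg" using ext_iset_empty adm_empty unfolding alg_iff by blast
  ultimately show ?thesis using alg_Pow by (simp add: ring_of_sets_iff)
qed

text \<open>By saturation a decreasing sequence of nonempty internal sets has a common point.
  Continuity at the empty set, and with it countable additivity of the density, becomes immediate:
  the sequence is eventually empty.\<close>

lemma alg_saturated:
  assumes X: "range X \<subseteq> alg" "decseq X" "(\<Inter>i. X i) = {}"
  shows "\<exists>i. X i = {}"
proof (rule ccontr)
  assume ne: "\<not> ?thesis"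
  have "\<forall>i. \<exists>a. a \<in> internal_subsets H \<and> X i = ext a" using X(1) by (auto simp: alg_def)
  from choice[OF this] obtain a where a: "\<forall>i. a i \<in> internal_subsets H \<and> X i = ext (a i)" ..
  have aU: "range a \<subseteq> U" using a by (auto simp: internal_subsets_def internal_sets_def)
  have "\<exists>x\<in>U. \<forall>b\<in>range a. Emem x b"
  proof (rule saturated[unfolded omega1_saturated_def, rule_format, folded U_def])
    show "range a \<subseteq> U \<and> countable (range a) \<and>
      (\<forall>G. finite G \<and> G \<subseteq> range a \<longrightarrow> (\<exists>x\<in>U. \<forall>b\<in>G. Emem x b))"
    proof (intro conjI allI impI aU)
      show "countable (range a)" by simp
      fix G assume "finite G \<and> G \<subseteq> range a"
      then obtain I where I: "finite I" "G = a ` I" by (meson finite_subset_image subset_UNIV)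
      define m where "m = Max (insert 0 I)"
      obtain x where x: "x \<in> X m" using ne by blast
      have "x \<in> X i" if "i \<in> I" for i
      proof -
        have "i \<le> m" using I that by (simp add: m_def)
        then show ?thesis using x decseqD[OF X(2)] by blast
      qed
      moreover have "x \<in> U" using x a by (auto simp: ext_def)
      ultimately show "\<exists>x\<in>U. \<forall>b\<in>G. Emem x b" using a I by (auto simp: ext_def intro!: bexI[of _ x])
    qed
  qed
  then obtain x where "x \<in> U" "\<And>i. Emem x (a i)" by blast
  then have "x \<in> (\<Inter>i. X i)" using a by (simp add: ext_def)
  with X(3) show False by simp
qed

text \<open>Disjoint extents only give representatives that are disjoint almost everywhere; this is
  read off from the representative of the intersection.\<close>

lemma dens_Un:
  assumes A: "adm A" "adm B" and disj: "ext (iset A) \<inter> ext (iset B) = {}"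
  shows "dens (\<lambda>w. A w \<union> B w) = dens A + dens B"
proof -
  let ?I = "\<lambda>w. A w \<inter> B w"
  have I: "adm ?I" "adm (\<lambda>w. A w \<union> B w)"
    using adm_op[OF A, of "(\<inter>)"] adm_op[OF A, of "(\<union>)"] by auto
  have "ext (iset ?I) = ext (iset A) \<inter> ext (iset B)"
    by (rule ext_iset_op[OF A]) (use A in \<open>auto simp: mem_ext_iset adm_def eventually_conj_iff\<close>)
  then have "ext (iset ?I) = ext (iset (\<lambda>w. {}))" using disj ext_iset_empty by simp
  then have "ev (\<lambda>w. ?I w = {})" using ext_iset_eq[OF I(1) adm_empty] by simp
  then have "ev (\<lambda>w. real (card (A w)) / real (h w) + real (card (B w)) / real (h w) =
      real (card (A w \<union> B w)) / real (h w))"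
    by eventually_elim (simp add: card_Un_disjoint adm_finite A add_divide_distrib)
  moreover have "((\<lambda>w. real (card (A w)) / real (h w) + real (card (B w)) / real (h w)) \<longlongrightarrow> dens A + dens B) W"
    by (intro tendsto_add dens_tendsto A)
  ultimately have "((\<lambda>w. real (card (A w \<union> B w)) / real (h w)) \<longlongrightarrow> dens A + dens B) W"
    by (blast intro: Lim_transform_eventually)
  then show ?thesis using dens_tendsto[OF I(2)] tendsto_unique[OF W_not_bot] by blast
qed

lemma loeb_measure:
  assumes "adm A"
  shows "ext (iset A) \<in> sets (loeb_space H)" "emeasure (loeb_space H) (ext (iset A)) = ennreal (dens A)"
proof -
  interpret ring_of_sets "Omega H" alg by (rule alg_ring)
  \<comment> \<open>Densities belong to representatives; the choice of one turns them into a set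
    function, and \<open>dens_cong\<close> makes the result independent of the choice.\<close>
  define \<mu> where "\<mu> = (\<lambda>X. ennreal (dens (SOME A. adm A \<and> X = ext (iset A))))"
  have \<mu>: "\<mu> (ext (iset A)) = ennreal (dens A)" if "adm A" for A
  proof -
    define B where "B = (SOME B. adm B \<and> ext (iset A) = ext (iset B))"
    have "adm B \<and> ext (iset A) = ext (iset B)"
      unfolding B_def by (rule someI[of _ A]) (use that in blast)
    then have "dens A = dens B" using dens_cong[OF that, of B] ext_iset_eq[OF that, of B] by simp
    then show ?thesis by (simp add: \<mu>_def B_def)
  qed
  have dens0: "dens (\<lambda>w. {}) = 0"
  proof (rule tendsto_unique[OF W_not_bot dens_tendsto[OF adm_empty]])
    show "((\<lambda>w. real (card {}) / real (h w)) \<longlongrightarrow> 0) W" by simp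
  qed
  have \<mu>0: "\<mu> {} = 0" using \<mu>[OF adm_empty] by (simp add: ext_iset_empty dens0)
  have "\<exists>\<mu>'. (\<forall>s\<in>alg. \<mu>' s = \<mu> s) \<and> measure_space (Omega H) (sigma_sets (Omega H) alg) \<mu>'"
  proof (rule caratheodory_empty_continuous)
    show "positive alg \<mu>" by (simp add: positive_def \<mu>0)
    show "additive alg \<mu>"
      unfolding additive_def
    proof (intro ballI impI)
      fix X Y assume "X \<in> alg" "Y \<in> alg" and disj: "X \<inter> Y = {}"
      then obtain A B where A: "adm A" "X = ext (iset A)" and B: "adm B" "Y = ext (iset B)"
        by (auto simp: alg_iff)
      have "adm (\<lambda>w. A w \<union> B w)" using adm_op[OF A(1) B(1), of "(\<union>)"] by simp
      then show "\<mu> (X \<union> Y) = \<mu> X + \<mu> Y"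
        using \<mu> A B ext_iset_Un[OF A(1) B(1)] dens_Un[OF A(1) B(1)] disj
        by (metis dens_nonneg ennreal_plus)
    qed
    show "\<mu> X \<noteq> \<infinity>" for X by (simp add: \<mu>_def)
    fix X :: "nat \<Rightarrow> 'c set" assume X: "range X \<subseteq> alg" "decseq X" "(\<Inter>i. X i) = {}"
    then obtain n where n: "X n = {}" using alg_saturated by blast
    have "X i = {}" if "n \<le> i" for i using decseqD[OF X(2) that] n by blast
    then have "eventually (\<lambda>i. \<mu> (X i) = 0) sequentially"
      using \<mu>0 by (auto simp: eventually_sequentially intro!: exI[of _ n])
    then show "(\<lambda>i. \<mu> (X i)) \<longlonglongrightarrow> 0" by (rule tendsto_eventually)
  qed
  then obtain \<mu>' where \<mu>': "\<And>s. s \<in> alg \<Longrightarrow> \<mu>' s = \<mu> s"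
    and ms: "measure_space (Omega H) (sigma_sets (Omega H) alg) \<mu>'" by blast
  \<comment> \<open>\<open>extend_measure\<close> takes the prescribed values only when some measure
    realizes them; the Caratheodory extension \<open>\<mu>'\<close> is such a measure.\<close>
  define L where "L = extend_measure (Omega H) (internal_subsets H) ext (\<lambda>a. ennreal (st (P H a)))"
  have sub: "ext ` internal_subsets H \<subseteq> Pow (Omega H)" using alg_Pow by (simp add: alg_def)
  have sL: "sets L = sigma_sets (Omega H) alg"
    unfolding L_def alg_def by (rule sets_extend_measure[OF sub])
  have em: "emeasure L (ext (iset B)) = ennreal (dens B)" if B: "adm B" for B
  proof -
    have "emeasure L (ext (iset B)) = ennreal (st (P H (iset B)))"
    proof (rule emeasure_extend_measure[OF L_def, of \<mu>'])
      show "\<mu>' (ext i) = ennreal (st (P H i))" if "i \<in> internal_subsets H" for i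
      proof -
        from that obtain C where C: "adm C" "i = iset C" by (auto simp: internal_subsets_adm)
        then have "ext i \<in> alg" by (auto simp: alg_iff)
        then show ?thesis using C \<mu>' \<mu> st_P by simp
      qed
      show "ext ` internal_subsets H \<subseteq> Pow (Omega H)" by (rule sub)
      show "positive (sets L) \<mu>'" "countably_additive (sets L) \<mu>'"
        using ms by (auto simp: sL measure_space_def)
      show "iset B \<in> internal_subsets H" using B by (simp add: internal_subsets_adm)
    qed
    then show ?thesis using st_P[OF B] by simp
  qed
  have s: "ext (iset A) \<in> sets L" using assms unfolding sL by (intro sigma_sets.Basic) (auto simp: alg_iff)
  have c: "loeb_space H = completion L" by (simp add: loeb_space_def L_def)
  show "ext (iset A) \<in> sets (loeb_space H)" unfolding c using s by (rule sets_completionI_sets)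
  show "emeasure (loeb_space H) (ext (iset A)) = ennreal (dens A)"
    unfolding c using s em[OF assms] by simp
qed

lemma space_loeb: "space (loeb_space H) = Omega H"
  using alg_Pow by (simp add: loeb_space_def space_extend_measure alg_def)

lemma Omega_ext: "adm (\<lambda>w. {1..h w})" "Omega H = ext (iset (\<lambda>w. {1..h w}))"
proof -
  show "adm (\<lambda>w. {1..h w})"
    using cs_map[OF csh, of "\<lambda>n. {1..n}"] by (simp add: adm_def)
  then show "Omega H = ext (iset (\<lambda>w. {1..h w}))"
    using Omega_iff[OF csh] by (auto simp: ext_iset adm_def)
qed

lemma finite_loeb: "finite_measure (loeb_space H)"
  using loeb_measure(2)[OF Omega_ext(1)] by (intro finite_measureI) (simp add: space_loeb Omega_ext(2))

end


section \<open>Counting functions of countably many coordinates\<close>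

lemma card_of_sequences:
  fixes A :: "'a set" and lam :: "'l rel"
  assumes lam: "lam ^c natLeq =o lam" and A: "|A| \<le>o lam"
  shows "|{f :: nat \<Rightarrow> 'a. \<forall>n. f n \<in> A}| \<le>o lam"
proof -
  have "Card_order lam"
    using lam Card_order_cexp Card_order_ordIso2 by blast
  then have "|A| \<le>o |Field lam|"
    using A card_of_Field_ordIso ordIso_symmetric ordLeq_ordIso_trans by blast
  then obtain f where f: "inj_on f A" "f ` A \<subseteq> Field lam" by (auto simp: card_of_ordLeq[symmetric])
  have "inj_on (\<lambda>s. f \<circ> s) {s :: nat \<Rightarrow> 'a. \<forall>n. s n \<in> A}"
    using f(1) by (auto simp: inj_on_def fun_eq_iff)
  moreover have "(\<lambda>s. f \<circ> s) ` {s :: nat \<Rightarrow> 'a. \<forall>n. s n \<in> A} \<subseteq> Func UNIV (Field lam)"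
    using f(2) by (auto simp: Func_def)
  ultimately have "|{s :: nat \<Rightarrow> 'a. \<forall>n. s n \<in> A}| \<le>o |Func (UNIV :: nat set) (Field lam)|"
    using card_of_ordLeq by blast
  moreover have "|Func (UNIV :: nat set) (Field lam)| =o lam"
    using lam by (simp add: cexp_def Field_natLeq)
  ultimately show ?thesis by (rule ordLeq_ordIso_trans)
qed

text \<open>An index seen through countably many coordinates fits into one set of naturals, hence
  into an element of \<open>V\<close>. Tag \<open>0\<close> carries the number in front.\<close>

definition idx_code :: "nat \<times> (nat \<Rightarrow> nat \<Rightarrow> nat set) \<Rightarrow> nat set" where
  "idx_code x = insert (prod_encode (0, fst x))
     {prod_encode (Suc i, prod_encode (j, m)) | i j m. m \<in> snd x i j}"

lemma inj_idx_code: "inj idx_code"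
proof (rule injI)
  fix x y assume e: "idx_code x = idx_code y"
  have 1: "prod_encode (0, n) \<in> idx_code z \<longleftrightarrow> n = fst z" for n z
    by (auto simp: idx_code_def)
  have 2: "prod_encode (Suc i, prod_encode (j, m)) \<in> idx_code z \<longleftrightarrow> m \<in> snd z i j" for i j m z
    by (auto simp: idx_code_def)
  have "fst x = fst y" using 1[of "fst x" x] 1[of "fst x" y] e by simp
  moreover have "snd x = snd y"
    using 2[of _ _ _ x] 2[of _ _ _ y] e by (simp add: fun_eq_iff set_eq_iff)
  ultimately show "x = y" by (rule prod_eqI)
qed

context superstructure
begin

lemma card_nat_set_le_V: "|UNIV :: nat set set| \<le>o |V|"
proof -
  have "inj (\<lambda>A. mk (num ` A))"
    by (rule injI) (simp add: mk_eq_iff[OF vbounded_nums vbounded_nums] inj_image_eq_iff[OF inj_num])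
  moreover have "range (\<lambda>A. mk (num ` A)) \<subseteq> V" using mk_V[OF vbounded_nums] by blast
  ultimately show ?thesis using card_of_ordLeq by blast
qed

text \<open>A function into \<open>V\<close> is recovered from the sequence of the intersections of its graph
  with the levels of \<open>V\<close>.\<close>

lemma card_of_coded_functions:
  assumes lam: "lam ^c natLeq =o lam" and V: "|V| \<le>o lam"
  shows "|{g :: nat \<times> (nat \<Rightarrow> nat \<Rightarrow> nat set) \<Rightarrow> 'v. \<forall>x. g x \<in> V}| \<le>o lam"
proof -
  let ?G = "{g :: nat \<times> (nat \<Rightarrow> nat \<Rightarrow> nat set) \<Rightarrow> 'v. \<forall>x. g x \<in> V}"
  define c where "c = (\<lambda>x. mk (num ` idx_code x))"
  have cV: "c x \<in> V" for x by (simp add: c_def mk_V[OF vbounded_nums])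
  have cinj: "c x = c y \<longleftrightarrow> x = y" for x y
    by (simp add: c_def mk_eq_iff[OF vbounded_nums vbounded_nums] inj_image_eq_iff[OF inj_num]
        inj_eq[OF inj_idx_code])
  define gr where "gr = (\<lambda>g. range (\<lambda>x. vpair (c x) (g x)))"
  define s where "s = (\<lambda>g n. mk (gr g \<inter> lev n))"
  have "inj_on s ?G"
  proof (rule inj_onI)
    fix g g' assume g: "g \<in> ?G" and g': "g' \<in> ?G" and eq: "s g = s g'"
    have sub: "gr g \<subseteq> V" "gr g' \<subseteq> V" using g g' cV vpair_V by (auto simp: gr_def)
    have b: "vbounded num mk (X \<inter> lev n)" for X n by (rule vboundedI) auto
    have "gr g \<inter> lev n = gr g' \<inter> lev n" for n
      using fun_cong[OF eq, of n] by (simp add: s_def mk_eq_iff[OF b b])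
    then have "gr g = gr g'" using sub unfolding std_univ_def by blast
    show "g = g'"
    proof
      fix x
      have "vpair (c x) (g x) \<in> gr g'" using \<open>gr g = gr g'\<close> by (auto simp: gr_def)
      then obtain y where "vpair (c x) (g x) = vpair (c y) (g' y)" by (auto simp: gr_def)
      moreover have "g x \<in> V" "g' y \<in> V" using g g' by blast+
      ultimately have "c x = c y \<and> g x = g' y" by (simp only: vpair_eq_iff cV)
      then show "g x = g' x" using cinj[of x y] by blast
    qed
  qed
  moreover have "s ` ?G \<subseteq> {f. \<forall>n. f n \<in> V}"
    by (auto simp: s_def intro!: mk_V vboundedI)
  ultimately have "|?G| \<le>o |{f :: nat \<Rightarrow> 'v. \<forall>n. f n \<in> V}|"
    using card_of_ordLeq by blast
  then show ?thesis using card_of_sequences[OF lam V] ordLeq_transitive by blast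
qed

text \<open>A function of countable support is recovered from a sequence enumerating the support and
  a function of the values found there. There are at most \<lambda>^\<omega> = \<lambda> of the
  former and, by the coding inside \<open>V\<close>, at most \<lambda> of the latter.\<close>

lemma card_of_vfuns:
  fixes lam :: "'l rel" and K :: "'k set"
  assumes lam: "lam ^c natLeq =o lam" and C: "Cinfinite lam" and V: "|V| \<le>o lam"
    and K: "|K| \<le>o lam" "K \<noteq> {}"
  shows "|vfuns num mk K| \<le>o lam"
proof -
  let ?S = "{\<sigma> :: nat \<Rightarrow> 'k. \<forall>n. \<sigma> n \<in> K}"
  let ?G = "{g :: nat \<times> (nat \<Rightarrow> nat \<Rightarrow> nat set) \<Rightarrow> 'v. \<forall>x. g x \<in> V}"
  define F where "F = (\<lambda>(\<sigma> :: nat \<Rightarrow> 'k, g :: nat \<times> (nat \<Rightarrow> nat \<Rightarrow> nat set) \<Rightarrow> 'v) (w :: 'k idx).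
      g (fst w, \<lambda>i. snd w (\<sigma> i)))"
  obtain k where k: "k \<in> K" using K(2) by blast
  have "vfuns num mk K \<subseteq> F ` (?S \<times> ?G)"
  proof
    fix f assume f: "f \<in> vfuns num mk K"
    then obtain J where J: "J \<subseteq> K" "countable J" "dep J f" unfolding vfuns_def cs_def by blast
    \<comment> \<open>The added point makes the support nonempty, so that it can be listed by a
      sequence defined on all naturals.\<close>
    let ?J = "insert k J"
    have cJ: "countable ?J" using J(2) by simp
    define \<sigma> where "\<sigma> = from_nat_into ?J"
    define g where "g = (\<lambda>x. f (fst x, \<lambda>j. snd x (to_nat_on ?J j)))"
    have "f w = F (\<sigma>, g) w" for w
    proof -
      have "agree J w (fst w, \<lambda>j. snd w (\<sigma> (to_nat_on ?J j)))"
        using cJ by (simp add: agree_def \<sigma>_def)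
      from J(3)[unfolded dep_def, rule_format, OF this] show ?thesis by (simp add: F_def g_def)
    qed
    then have "f = F (\<sigma>, g)" by blast
    moreover have "\<sigma> n \<in> K" for n
      using subsetD[of ?J K, OF _ from_nat_into[of ?J n]] J(1) k by (simp add: \<sigma>_def)
    moreover have "g x \<in> V" for x using f unfolding g_def vfuns_def by blast
    ultimately show "f \<in> F ` (?S \<times> ?G)" by blast
  qed
  then have "|vfuns num mk K| \<le>o |?S \<times> ?G|" by (rule surj_imp_ordLeq)
  also have "|?S \<times> ?G| \<le>o lam"
    using C card_of_sequences[OF lam K(1)] card_of_coded_functions[OF lam V]
    by (intro card_of_Times_ordLeq_infinite_Field) (auto simp: cinfinite_def)
  finally show ?thesis .
qed

end


section \<open>Stages\<close>

text \<open>The lexicographic product looks at second components only on ties; the intersection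
  keeps all components within the two fields.\<close>

definition stage_order :: "'l rel \<Rightarrow> (stage \<times> 'l) rel" where
  "stage_order lam = ((kap - Id) <*lex*> (lam - Id)) \<inter>
     ((Field kap \<times> Field lam) \<times> (Field kap \<times> Field lam))"

lemma Well_order_kap: "Well_order kap"
  using Cinfinite_cardSuc[OF Cinfinite_nat_set] unfolding card_order_on_def by auto

lemma Well_order_strict_total:
  assumes "Well_order r" "a \<in> Field r" "b \<in> Field r"
  shows "a = b \<or> (a, b) \<in> r - Id \<or> (b, a) \<in> r - Id"
  using assms wo_rel.TOTALS[of r] unfolding wo_rel_def by blast

lemma trans_strict: "Well_order r \<Longrightarrow> trans (r - Id)"
  using wo_rel.TRANS[of r] wo_rel.ANTISYM[of r] trans_diff_Id unfolding wo_rel_def by blast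

lemma stage_order_props:
  assumes "Well_order lam"
  shows "wf (stage_order lam)" "trans (stage_order lam)"
    "stage_order lam \<subseteq> (Field kap \<times> Field lam) \<times> (Field kap \<times> Field lam)"
    "\<And>i j. i \<in> Field kap \<times> Field lam \<Longrightarrow> j \<in> Field kap \<times> Field lam \<Longrightarrow>
      i = j \<or> (i, j) \<in> stage_order lam \<or> (j, i) \<in> stage_order lam"
proof -
  show "wf (stage_order lam)"
    unfolding stage_order_def
    by (rule wf_subset[OF wf_lex_prod[OF wf_underS[OF Well_order_kap] wf_underS[OF assms]]]) blast
  have t: "trans ((kap - Id) <*lex*> (lam - Id))"
    by (intro trans_lex_prod trans_strict Well_order_kap assms)
  show "trans (stage_order lam)"
    unfolding stage_order_def by (rule trans_Int[OF t]) (rule transI, blast)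
  show "stage_order lam \<subseteq> (Field kap \<times> Field lam) \<times> (Field kap \<times> Field lam)"
    unfolding stage_order_def by blast
  fix i j assume "i \<in> Field kap \<times> Field lam" "j \<in> Field kap \<times> Field lam"
  then show "i = j \<or> (i, j) \<in> stage_order lam \<or> (j, i) \<in> stage_order lam"
    using Well_order_strict_total[OF Well_order_kap, of "fst i" "fst j"]
      Well_order_strict_total[OF assms, of "snd i" "snd j"]
    by (cases i; cases j) (auto simp: stage_order_def)
qed

text \<open>A strict bound \<open>b\<close> on the first components, available by regularity of
  \<open>kap\<close>, puts \<open>J\<close> below every coordinate of the block
  \<open>b\<close>.\<close>

lemma countable_stage_bounded:
  assumes "countable J" "J \<subseteq> Field kap \<times> Field lam"
  obtains b where "b \<in> Field kap" "\<And>i. i \<in> Field lam \<Longrightarrow> J \<subseteq> below (stage_order lam) (b, i)"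
proof -
  have sub: "fst ` J \<subseteq> Field kap" using assms(2) by auto
  have "|fst ` J| \<le>o |UNIV :: nat set|" using assms(1) by (simp add: countable_iff_le[symmetric])
  also have "|UNIV :: nat set| \<le>o |UNIV :: nat set set|"
    using card_of_Pow[of "UNIV :: nat set"] by (simp add: ordLess_imp_ordLeq)
  finally have "|fst ` J| \<le>o |UNIV :: nat set set|" .
  from strictly_bounded_cardSuc[OF Cinfinite_nat_set sub this]
  obtain b where b: "b \<in> Field kap" "fst ` J \<subseteq> underS kap b" .
  have "J \<subseteq> below (stage_order lam) (b, i)" if "i \<in> Field lam" for i
    using b assms(2) that by (fastforce simp: below_def stage_order_def underS_def)
  with b(1) that show thesis by blast
qed

lemma dep_coord: "k \<in> L \<Longrightarrow> dep L h \<Longrightarrow> dep L (\<lambda>w. \<Phi> (snd w k) (h w))"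
  unfolding dep_def by (metis agree_def)

section \<open>Size and non-compactness for the generic ultrafilter\<close>

locale staged_universe = infinite_loeb num mk K W q h
  for num :: "nat \<Rightarrow> 'v" and mk :: "'v set \<Rightarrow> 'v" and K :: "(stage \<times> 'l) set" and W
    and q :: "((stage \<times> 'l) idx \<Rightarrow> 'v) \<Rightarrow> 'l" and h +
  fixes lam :: "'l rel"
  assumes lam: "Cinfinite lam" and K: "K = Field kap \<times> Field lam"
    and q_Field: "q ` vfuns num mk K \<subseteq> Field lam"
    and generic: "\<And>j f h. j \<in> K \<Longrightarrow> dep (below (stage_order lam) j) f \<Longrightarrow>
      dep (below (stage_order lam) j) h \<Longrightarrow> (\<And>n. eventually (\<lambda>w. n \<le> h w) W) \<Longrightarrow>
      eventually (\<lambda>w. f w \<in> cover (snd w j) (h w)) W"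
begin

lemma wo_lam: "Well_order lam"
  using lam unfolding card_order_on_def by blast

lemma cs_bounded:
  assumes "cs K f"
  obtains b where "b \<in> Field kap" "\<And>i. i \<in> Field lam \<Longrightarrow> dep (below (stage_order lam) (b, i)) f"
proof -
  obtain J where J: "J \<subseteq> K" "countable J" "dep J f" using assms unfolding cs_def by blast
  obtain b where b: "b \<in> Field kap" "\<And>i. i \<in> Field lam \<Longrightarrow> J \<subseteq> below (stage_order lam) (b, i)"
    using countable_stage_bounded[OF J(2), of lam] J(1) K by blast
  show thesis by (rule that[OF b(1) dep_mono[OF J(3) b(2)]])
qed

definition avoid :: "stage \<times> 'l \<Rightarrow> (stage \<times> 'l) idx \<Rightarrow> nat set" where
  "avoid k w = {1..h w} - cover (snd w k) (h w)"

lemma adm_avoid: "k \<in> K \<Longrightarrow> adm (avoid k)"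
  unfolding adm_def avoid_def
  using cs_map2[OF cs_coord csh, of k "\<lambda>x n. {1..n} - cover x n"] by auto

lemma card_avoid: "h w \<le> 2 * card (avoid k w)"
proof -
  have "card {1..h w} - card (cover (snd w k) (h w)) \<le> card (avoid k w)"
    unfolding avoid_def by (intro diff_card_le_card_Diff) simp
  then show ?thesis using card_cover[of "snd w k" "h w"] by simp
qed

lemma dens_avoid: "k \<in> K \<Longrightarrow> 1 / 2 \<le> dens (avoid k)"
proof (rule tendsto_lowerbound[OF dens_tendsto[OF adm_avoid] _ W_not_bot])
  have "ev (\<lambda>w. 1 \<le> h w)" by (rule h_inf)
  then show "ev (\<lambda>w. 1 / 2 \<le> real (card (avoid k w)) / real (h w))"
  proof eventually_elim
    case (elim w)
    have "real (h w) \<le> 2 * real (card (avoid k w))" using card_avoid[of w k] by linarith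
    then show ?case using elim by (simp add: field_simps)
  qed
qed

text \<open>In a block \<open>b\<close> above the support of \<open>h\<close>, the least point
  avoiding the set at \<open>(b, i)\<close> depends on that coordinate and on \<open>h\<close> only.
  For \<open>i\<close> before \<open>j\<close> it is therefore caught by the set at
  \<open>(b, j)\<close>, which misses the point belonging to \<open>j\<close>; so different
  coordinates of the block give different points. The upper bound comes from \<open>q\<close> taking
  its values in \<open>Field lam\<close>.\<close>

lemma card_Omega: "|Omega H| =o lam"
proof -
  have "Omega H \<subseteq> Field lam"
  proof
    fix x assume "x \<in> Omega H"
    then obtain g where "cs K g" "x = q (\<lambda>w. num (g w))" unfolding Omega_iff[OF csh] by blast
    then show "x \<in> Field lam" using q_Field fn_num by blast
  qed
  then have le: "|Omega H| \<le>o lam"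
    using card_of_mono1 card_of_Field_ordIso lam ordLeq_ordIso_trans by blast
  obtain b where b: "b \<in> Field kap" "\<And>i. i \<in> Field lam \<Longrightarrow> dep (below (stage_order lam) (b, i)) h"
    using cs_bounded[OF csh] by blast
  define pick where "pick = (\<lambda>x n. Min ({1..n} - cover x n))"
  define g where "g = (\<lambda>i w. pick (snd w (b, i)) (h w))"
  have bK: "(b, i) \<in> K" if "i \<in> Field lam" for i using b(1) that by (simp add: K)
  have csg: "cs K (g i)" if "i \<in> Field lam" for i
    unfolding g_def by (rule cs_map2[OF cs_coord[OF bK[OF that]] csh])
  have g: "ev (\<lambda>w. g i w \<in> avoid (b, i) w)" for i
    using h_inf[of 1]
  proof eventually_elim
    case (elim w)
    then have "avoid (b, i) w \<noteq> {}" using card_avoid[of w "(b, i)"] by auto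
    then show ?case unfolding g_def pick_def avoid_def by (intro Min_in) auto
  qed
  let ?x = "\<lambda>i. q (\<lambda>w. num (g i w))"
  have "?x i \<in> Omega H" if "i \<in> Field lam" for i
  proof -
    have "ev (\<lambda>w. g i w \<in> {1..h w})" using g[of i] by eventually_elim (simp add: avoid_def)
    then show ?thesis using csg[OF that] Omega_iff[OF csh] by blast
  qed
  note in_Omega = this
  have ne: "?x i \<noteq> ?x j" if ij: "i \<in> Field lam" "j \<in> Field lam" "(i, j) \<in> lam - Id" for i j
  proof
    assume "?x i = ?x j"
    then have eq: "ev (\<lambda>w. g i w = g j w)" using q_num_eq[OF csg csg] ij by blast
    have lt: "((b, i), (b, j)) \<in> stage_order lam" using ij b(1) by (simp add: stage_order_def)
    have "(b, i) \<in> below (stage_order lam) (b, j)" using lt by (simp add: below_def)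
    then have "dep (below (stage_order lam) (b, j)) (g i)"
      unfolding g_def by (rule dep_coord) (rule b(2)[OF ij(2)])
    from generic[OF bK[OF ij(2)] this b(2)[OF ij(2)] h_inf]
    have "ev (\<lambda>w. g i w \<in> cover (snd w (b, j)) (h w))" .
    with eq g[of j] have "ev (\<lambda>w. False)" by eventually_elim (simp add: avoid_def)
    then show False by (simp add: ultra_eventually_const[OF ultraW])
  qed
  have "inj_on ?x (Field lam)"
  proof (rule inj_onI, rule ccontr)
    fix i j assume "i \<in> Field lam" "j \<in> Field lam" "?x i = ?x j" "i \<noteq> j"
    then show False using Well_order_strict_total[OF wo_lam, of i j] ne[of i j] ne[of j i] by auto
  qed
  then have "|Field lam| \<le>o |Omega H|" by (rule card_of_ordLeqI) (rule in_Omega)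
  then have "lam \<le>o |Omega H|"
    using card_of_Field_ordIso lam ordIso_symmetric ordIso_ordLeq_trans by blast
  with le show ?thesis by (simp add: ordIso_iff_ordLeq)
qed

lemma not_compact: "\<not> compact_measure_space (loeb_space H)"
proof
  assume "compact_measure_space (loeb_space H)"
  then obtain C where C: "C \<subseteq> sets (loeb_space H)" "compact_family C"
    "inner_regular_family (loeb_space H) C" unfolding compact_measure_space_def by blast
  interpret L: finite_measure "loeb_space H" by (rule finite_loeb)
  have "Field lam \<noteq> {}" using lam unfolding cinfinite_def by auto
  then obtain i where i: "i \<in> Field lam" by blast
  have bK: "(b, i) \<in> K" if "b \<in> Field kap" for b using that i by (simp add: K)
  let ?A = "\<lambda>b. ext (iset (avoid (b, i)))"
  have "\<forall>b\<in>Field kap. \<exists>B. B \<in> C \<and> B \<subseteq> ?A b \<and> 0 < emeasure (loeb_space H) B"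
  proof
    fix b assume b: "b \<in> Field kap"
    note A = adm_avoid[OF bK[OF b]]
    have "0 < emeasure (loeb_space H) (?A b)"
      unfolding loeb_measure(2)[OF A] using dens_avoid[OF bK[OF b]] by simp
    also have "emeasure (loeb_space H) (?A b) =
        (SUP B\<in>{B \<in> C. B \<subseteq> ?A b}. emeasure (loeb_space H) B)"
      using C(3) loeb_measure(1)[OF A] unfolding inner_regular_family_def by blast
    finally show "\<exists>B. B \<in> C \<and> B \<subseteq> ?A b \<and> 0 < emeasure (loeb_space H) B"
      unfolding less_SUP_iff by blast
  qed
  from bchoice[OF this] obtain B where
    B: "\<forall>b\<in>Field kap. B b \<in> C \<and> B b \<subseteq> ?A b \<and> 0 < emeasure (loeb_space H) (B b)" ..
  obtain T where T: "kap_unbounded T"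
    and fip: "\<And>F. finite F \<Longrightarrow> F \<subseteq> T \<Longrightarrow> F \<noteq> {} \<Longrightarrow> (\<Inter>b\<in>F. B b) \<noteq> {}"
  proof (rule L.kap_precaliber)
    show "B b \<in> sets (loeb_space H)" if "b \<in> Field kap" for b using that B C(1) by blast
    show "0 < measure (loeb_space H) (B b)" if "b \<in> Field kap" for b
      using that B by (simp add: L.emeasure_eq_measure)
  qed (rule that)
  have TF: "T \<subseteq> Field kap" using T by (simp add: kap_unbounded_def)
  have "\<Inter>(B ` T) \<noteq> {}"
  proof (rule C(2)[unfolded compact_family_def, rule_format])
    show "B ` T \<subseteq> C" using B TF by blast
    fix F assume "finite F \<and> F \<subseteq> B ` T"
    then obtain T' where "finite T'" "T' \<subseteq> T" "F = B ` T'" by (meson finite_subset_image)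
    then show "\<Inter>F \<noteq> {}" using fip[of T'] by (cases "T' = {}") auto
  qed
  then obtain x where x: "\<And>b. b \<in> T \<Longrightarrow> x \<in> ?A b" using B TF by blast
  \<comment> \<open>Existence of a stage makes the unbounded set \<open>T\<close> nonempty. One
    membership of \<open>x\<close> suffices to see that it is a hypernatural, with a representative
    \<open>g\<close> of countable support.\<close>
  obtain c where "c \<in> Field kap" using cs_bounded[OF csh] by blast
  then obtain b0 where "b0 \<in> T" using T unfolding kap_unbounded_def by blast
  then have "x \<in> ext (iset (avoid (b0, i)))" "(b0, i) \<in> K" using x TF bK by auto
  then have "x \<in> hypernat" using ext_iset_hypernat adm_avoid unfolding adm_def by blast
  then obtain g where g: "cs K g" "x = q (\<lambda>w. num (g w))" by (auto simp: hypernat_iff)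
  \<comment> \<open>Bounding the pair puts the point and the length of the interval below the same
    stage, as \<open>generic\<close> demands.\<close>
  obtain c where c: "c \<in> Field kap"
    "\<And>i. i \<in> Field lam \<Longrightarrow> dep (below (stage_order lam) (c, i)) (\<lambda>w. (g w, h w))"
    using cs_bounded[OF cs_Pair[OF g(1) csh]] by blast
  obtain b where b: "b \<in> T" "c \<in> underS kap b" using T c(1) unfolding kap_unbounded_def by blast
  have bF: "b \<in> Field kap" using b TF by blast
  have "((c, i), (b, i)) \<in> stage_order lam"
    using b(2) bF c(1) i by (auto simp: stage_order_def underS_def)
  then have "below (stage_order lam) (c, i) \<subseteq> below (stage_order lam) (b, i)"
    using stage_order_props(2)[OF wo_lam] unfolding below_def trans_def by blast
  then have d: "dep (below (stage_order lam) (b, i)) (\<lambda>w. (g w, h w))" by (rule dep_mono[OF c(2)[OF i]])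
  have "ev (\<lambda>w. g w \<in> cover (snd w (b, i)) (h w))"
    by (rule generic[OF bK[OF bF] _ _ h_inf]) (use d in \<open>auto simp: dep_def\<close>)
  moreover have "ev (\<lambda>w. g w \<in> avoid (b, i) w)"
    using x[OF b(1)] mem_ext_iset[OF _ g(1)] adm_avoid[OF bK[OF bF]] g(2) by (simp add: adm_def)
  ultimately have "ev (\<lambda>w. False)" by eventually_elim (simp add: avoid_def)
  then show False by (simp add: ultra_eventually_const[OF ultraW])
qed

end


theorem theorem13:
  fixes num :: "nat \<Rightarrow> 'v" and mk :: "'v set \<Rightarrow> 'v" and lam :: "'l rel"
  assumes "superstructure num mk"
    and "Card_order lam"
    and "|std_univ num mk| <o lam"
    and "lam ^c natLeq =o lam"
  shows "\<exists>(M :: 'l set) E star. nonstandard_universe num mk M E star \<and>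
    (\<forall>H \<in> nonstandard_universe.infinite_hypernat num mk M E star.
       |nonstandard_universe.Omega num mk M E star H| =o lam \<and>
       \<not> compact_measure_space (nonstandard_universe.loeb_space num mk M E star H))"
proof -
  interpret superstructure num mk by (rule assms(1))
  have V: "|V| \<le>o lam" using assms(3) by (rule ordLess_imp_ordLeq)
  \<comment> \<open>The sets of naturals embed into \<open>V\<close>, so the continuum is smaller
    than \<lambda> and its successor \<open>kap\<close> is at most \<lambda>.\<close>
  have "|UNIV :: nat set set| <o lam"
    using card_nat_set_le_V assms(3) by (rule ordLeq_ordLess_trans)
  then have kl: "kap \<le>o lam"
    using cardSuc_ordLess_ordLeq[OF card_of_Card_order assms(2)] by blast
  have kC: "Cinfinite kap" by (rule Cinfinite_cardSuc[OF Cinfinite_nat_set])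
  have lC: "Cinfinite lam" using cinfinite_mono[OF kl] kC assms(2) by blast
  have wo: "Well_order lam" using assms(2) unfolding card_order_on_def by blast
  define K where "K = Field kap \<times> Field lam"
  have "|Field kap| \<le>o lam"
    using card_of_Field_ordIso kC kl ordIso_ordLeq_trans by blast
  moreover have "|Field lam| \<le>o lam"
    using card_of_Field_ordIso assms(2) ordIso_imp_ordLeq by blast
  ultimately have Kl: "|K| \<le>o lam"
    unfolding K_def using lC by (intro card_of_Times_ordLeq_infinite_Field) (auto simp: cinfinite_def)
  have "Field kap \<noteq> {}" "Field lam \<noteq> {}" using kC lC unfolding cinfinite_def by auto
  then have K0: "K \<noteq> {}" by (simp add: K_def)
  obtain W where W: "ultra W" "\<And>n. eventually (\<lambda>w. n \<le> fst w) W"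
    and gen: "\<And>j f h. j \<in> K \<Longrightarrow> dep (below (stage_order lam) j) f \<Longrightarrow>
      dep (below (stage_order lam) j) h \<Longrightarrow> (\<And>n. eventually (\<lambda>w. n \<le> h w) W) \<Longrightarrow>
      eventually (\<lambda>w. f w \<in> cover (snd w j) (h w)) W"
  proof (rule generic_ultrafilter[OF stage_order_props(1-3)[OF wo], folded K_def])
    show "i = j \<or> (i, j) \<in> stage_order lam \<or> (j, i) \<in> stage_order lam"
      if "i \<in> K" "j \<in> K" for i j
      using that unfolding K_def by (rule stage_order_props(4)[OF wo])
    fix W :: "(stage \<times> 'l) idx filter"
    assume "ultra W" "\<And>n. eventually (\<lambda>w. n \<le> fst w) W"
      "\<And>j f h. j \<in> K \<Longrightarrow> dep (below (stage_order lam) j) f \<Longrightarrow>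
        dep (below (stage_order lam) j) h \<Longrightarrow> (\<And>n. eventually (\<lambda>w. n \<le> h w) W) \<Longrightarrow>
        eventually (\<lambda>w. f w \<in> cover (snd w j) (h w)) W"
    then show thesis by (rule that)
  qed
  let ?fn = "vfuns num mk K"
  have "|?fn| \<le>o |Field lam|"
    using card_of_vfuns[OF assms(4) lC V Kl K0] card_of_Field_ordIso[OF assms(2)]
      ordIso_symmetric ordLeq_ordIso_trans by blast
  then obtain \<psi> where \<psi>: "inj_on \<psi> ?fn" "\<psi> ` ?fn \<subseteq> Field lam"
    by (auto simp: card_of_ordLeq[symmetric])
  \<comment> \<open>Equality almost everywhere is turned into equality by choosing one
    representative per class; injecting the functions into \<open>Field lam\<close> then realizes
    the quotient on the carrier of \<lambda>.\<close>
  define rep where "rep = (\<lambda>f. SOME g. g \<in> ?fn \<and> eventually (\<lambda>w. f w = g w) W)"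
  define q where "q = (\<lambda>f. \<psi> (rep f))"
  have rep: "rep f \<in> ?fn \<and> eventually (\<lambda>w. f w = rep f w) W" if "f \<in> ?fn" for f
    unfolding rep_def by (rule someI[of _ f]) (use that in simp)
  have q: "q f = q g \<longleftrightarrow> eventually (\<lambda>w. f w = g w) W" if fg: "f \<in> ?fn" "g \<in> ?fn" for f g
  proof
    assume "q f = q g"
    then have "rep f = rep g" using \<psi>(1) rep fg unfolding q_def inj_on_def by blast
    moreover have "eventually (\<lambda>w. f w = rep f w) W" "eventually (\<lambda>w. g w = rep g w) W"
      using rep fg by blast+
    ultimately show "eventually (\<lambda>w. f w = g w) W" by (auto elim: eventually_elim2)
  next
    assume e: "eventually (\<lambda>w. f w = g w) W"
    have "eventually (\<lambda>w. f w = k w) W \<longleftrightarrow> eventually (\<lambda>w. g w = k w) W" for k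
      by (rule eventually_cong[OF e]) simp
    then show "q f = q g" unfolding q_def rep_def by simp
  qed
  interpret ultra_universe num mk K W q
    by unfold_locales (fact W q)+
  show ?thesis
  proof (intro exI conjI ballI)
    show "nonstandard_universe num mk Mod Emem star" by unfold_locales
    fix H assume "H \<in> infinite_hypernat"
    then obtain h where h: "cs K h" "\<And>n. ev (\<lambda>w. n \<le> h w)" "H = q (\<lambda>w. num (h w))"
      by (auto simp: infinite_hypernat_iff)
    interpret staged_universe num mk K W q h lam
    proof unfold_locales
      show "q ` ?fn \<subseteq> Field lam" using rep \<psi>(2) unfolding q_def by blast
    qed (fact h lC K_def gen)+
    show "|Omega H| =o lam" "\<not> compact_measure_space (loeb_space H)"
      unfolding h(3) by (rule card_Omega not_compact)+
  qed
qed

end
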